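(* Let $P=(\Sigma,R)$ be a TSS in the ntyft/ntyxt format with recursion. Then the bisimulation preorder $\sqsubseteq_B$ is a lean precongruence: for every term $t\in\mathbb{T}(\Sigma)$ and all closed substitutions $\rho,\nu:\mathrm{Var}\to\mathrm{T}(\Sigma)$ with $\rho(x)\sqsubseteq_B\nu(x)$ for all $x\in\mathrm{Var}$, one has $t[\rho]\sqsubseteq_B t[\nu]$.
   Context: Terms with recursion $\mathbb{T}(\Sigma)$ over $\Sigma$: variables, $f(t_1,\dots,t_n)$ for $(f,n)\in\Sigma$, and $\langle X|S\rangle$ for $S:V_S\to\mathbb{T}(\Sigma)$, $V_S\subseteq\mathrm{Var}$, $X\in V_S$ (binding $V_S$). $\mathrm{T}(\Sigma)$ = closed terms. A closed substitution is a total map $\mathrm{Var}\to\mathrm{T}(\Sigma)$; $t[\rho]$ is capture-avoiding replacement of free variables. $\langle t|S\rangle$ abbreviates $t[\langle Y|S\rangle/Y]_{Y\in V_S}$. Literals $t\xrightarrow{a}t'$ and $t\not\xrightarrow{a}$ deny each other; rules $\frac{H}{\alpha}$; TSS $P=(\Sigma,R)$; $P\vdash\frac{H}{\alpha}$ means a well-founded proof tree exists whose leaves lie in $H$ and whose other nodes are substitution instances of rules in $R$. Well-founded semantics: for ordinals $\lambda$, $PT^-_\lambda$ = closed negative literals denying no element of $CT^+_\kappa$ for $\kappa<\lambda$; $PT^+_\lambda$ = closed positive $\beta$ with $P\vdash\frac{PT^-_\lambda}{\beta}$; $CT^-_\lambda$ = closed negative literals denying no element of $PT^+_\lambda$; $CT^+_\lambda$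 = closed positive $\beta$ with $P\vdash\frac{CT^-_\lambda}{\beta}$; these stabilise to $CT^+,PT^+$. Write $P\vdash p\xrightarrow{a}q$ for $(p\xrightarrow{a}q)\in CT^+$ and $P\vdash p\dashrightarrow^{a}q$ for $(p\xrightarrow{a}q)\in PT^+$. A bisimulation is a relation $\mathcal{R}\subseteq\mathrm{T}(\Sigma)\times\mathrm{T}(\Sigma)$ such that whenever $p\mathcal{R}q$: if $P\vdash p\xrightarrow{a}p'$ then there is $q'$ with $P\vdash q\xrightarrow{a}q'$ and $p'\mathcal{R}q'$; and if $P\vdash q\dashrightarrow^{a}q'$ then there is $p'$ with $P\vdash p\dashrightarrow^{a}p'$ and $p'\mathcal{R}q'$. $p\sqsubseteq_B q$ (modal refinement / bisimilarity) iff some bisimulation relates them. ntyft/ntyxt format with recursion: for every recursive specification $S$, $X\in V_S$, $a\in A$ the TSS contains the rule $\frac{\langle S_X|S\rangle\xrightarrow{a}z}{\langle X|S\rangle\xrightarrow{a}z}$, and all other rules are ntyft or ntyxt rules, where an ntytt rule is one whose positive premises have as right-hand sides distinct variables not occurring in the source; it is ntyxt if the source is a variable and ntyft if the source contains exactly one function symbol and no repeated variables. *)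

theory Defs
  imports Main
begin

text \<open>Terms over function symbols 'f and variables 'v.
  A recursive specification S is a partial map from variables to terms;
  its domain dom S is V_S. Rec X S stands for the recursion construct <X|S>.\<close>

datatype ('f, 'v) rterm =
    Var 'v
  | Fn 'f "('f, 'v) rterm list"
  | Rec 'v "'v \<Rightarrow> ('f, 'v) rterm option"

type_synonym 'f signature = "('f \<times> nat) set"

primrec wf_term :: "'f signature \<Rightarrow> ('f, 'v) rterm \<Rightarrow> bool" where
  "wf_term Sig (Var x) = True"
| "wf_term Sig (Fn f ts) = ((f, length ts) \<in> Sig \<and> list_all (wf_term Sig) ts)"
| "wf_term Sig (Rec X S) =
     (X \<in> dom S \<and> (\<forall>b \<in> ran (map_option (wf_term Sig) \<circ> S). b))"

primrec fv :: "('f, 'v) rterm \<Rightarrow> 'v set" where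
  "fv (Var x) = {x}"
| "fv (Fn f ts) = \<Union> (set (map fv ts))"
| "fv (Rec X S) = \<Union> (ran (map_option fv \<circ> S)) - dom S"

definition closed :: "'f signature \<Rightarrow> ('f, 'v) rterm \<Rightarrow> bool" where
  "closed Sig t \<longleftrightarrow> wf_term Sig t \<and> fv t = {}"

definition closed_subst :: "'f signature \<Rightarrow> ('v \<Rightarrow> ('f, 'v) rterm) \<Rightarrow> bool" where
  "closed_subst Sig \<rho> \<longleftrightarrow> (\<forall>x. closed Sig (\<rho> x))"

text \<open>Replacement of free variables. Bound variables (those in dom S of a
  recursion construct) are not replaced. When all replacing terms are closed
  (the only way it is used below) this is capture-avoiding substitution.\<close>
primrec subst_aux :: "('f, 'v) rterm \<Rightarrow> ('v \<Rightarrow> ('f, 'v) rterm) \<Rightarrow> ('f, 'v) rterm" where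
  "subst_aux (Var x) \<sigma> = \<sigma> x"
| "subst_aux (Fn f ts) \<sigma> = Fn f (map (\<lambda>u. subst_aux u \<sigma>) ts)"
| "subst_aux (Rec X S) \<sigma> =
     Rec X (map_option (\<lambda>u. subst_aux u (\<lambda>Z. if Z \<in> dom S then Var Z else \<sigma> Z)) \<circ> S)"

definition subst :: "('f, 'v) rterm \<Rightarrow> ('v \<Rightarrow> ('f, 'v) rterm) \<Rightarrow> ('f, 'v) rterm"
    ("_\<lbrakk>_\<rbrakk>" [1000, 0] 1000) where
  "t\<lbrakk>\<rho>\<rbrakk> = subst_aux t \<rho>"

text \<open><t|S> = t[<Y|S>/Y] for Y in V_S (other variables are left unchanged).
  It is only used for closed <X|S> and t = S_X, where all free variables
  of t lie in V_S and the replacing terms <Y|S> are closed.\<close>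
definition unfold :: "('v \<Rightarrow> ('f, 'v) rterm option) \<Rightarrow> ('f, 'v) rterm \<Rightarrow> ('f, 'v) rterm" where
  "unfold S t = t\<lbrakk>\<lambda>Y. if Y \<in> dom S then Rec Y S else Var Y\<rbrakk>"

datatype ('f, 'v, 'a) lit =
    Trans "('f, 'v) rterm" 'a "('f, 'v) rterm"
  | NoTrans "('f, 'v) rterm" 'a

type_synonym ('f, 'v, 'a) rule = "('f, 'v, 'a) lit set \<times> ('f, 'v, 'a) lit"

fun lit_terms :: "('f, 'v, 'a) lit \<Rightarrow> ('f, 'v) rterm set" where
  "lit_terms (Trans t a u) = {t, u}"
| "lit_terms (NoTrans t a) = {t}"

fun subst_lit :: "('v \<Rightarrow> ('f, 'v) rterm) \<Rightarrow> ('f, 'v, 'a) lit \<Rightarrow> ('f, 'v, 'a) lit" where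
  "subst_lit \<sigma> (Trans t a u) = Trans (t\<lbrakk>\<sigma>\<rbrakk>) a (u\<lbrakk>\<sigma>\<rbrakk>)"
| "subst_lit \<sigma> (NoTrans t a) = NoTrans (t\<lbrakk>\<sigma>\<rbrakk>) a"

definition closed_lit :: "'f signature \<Rightarrow> ('f, 'v, 'a) lit \<Rightarrow> bool" where
  "closed_lit Sig l \<longleftrightarrow> (\<forall>t \<in> lit_terms l. closed Sig t)"

fun is_pos :: "('f, 'v, 'a) lit \<Rightarrow> bool" where
  "is_pos (Trans _ _ _) = True"
| "is_pos (NoTrans _ _) = False"

fun denies :: "('f, 'v, 'a) lit \<Rightarrow> ('f, 'v, 'a) lit \<Rightarrow> bool" where
  "denies (NoTrans t a) (Trans t' a' u) = (t = t' \<and> a = a')"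
| "denies (Trans t' a' u) (NoTrans t a) = (t = t' \<and> a = a')"
| "denies _ _ = False"

definition tss :: "'f signature \<Rightarrow> ('f, 'v, 'a) rule set \<Rightarrow> bool" where
  "tss Sig R \<longleftrightarrow> (\<forall>(H, c) \<in> R. \<forall>l \<in> insert c H. \<forall>t \<in> lit_terms l. wf_term Sig t)"

text \<open>Provability P |- H/alpha for the TSS P consisting of the rules R together
  with the recursion rules  <S_X|S> --a--> z / <X|S> --a--> z  (for every
  recursive specification S over Sig, X in V_S, action a).
  Proofs are well-founded trees (inductive definition); a node is either a
  leaf labelled by an element of H, or is a substitution instance of a rule
  whose premises label its children. Closed substitutions are used for
  instances; for the recursion rules the closed instances are exactly those
  with closed <X|S> and closed target.\<close>
inductive proves :: "'f signature \<Rightarrow> ('f, 'v, 'a) rule set \<Rightarrow> ('f, 'v, 'a) lit set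
                      \<Rightarrow> ('f, 'v, 'a) lit \<Rightarrow> bool"
  for Sig R H where
  hyp: "\<alpha> \<in> H \<Longrightarrow> proves Sig R H \<alpha>"
| inst: "(Hr, c) \<in> R \<Longrightarrow> closed_subst Sig \<sigma> \<Longrightarrow>
         (\<forall>\<beta> \<in> Hr. proves Sig R H (subst_lit \<sigma> \<beta>)) \<Longrightarrow>
         proves Sig R H (subst_lit \<sigma> c)"
| recu: "closed Sig (Rec X S) \<Longrightarrow> closed Sig q \<Longrightarrow>
         proves Sig R H (Trans (unfold S (the (S X))) a q) \<Longrightarrow>
         proves Sig R H (Trans (Rec X S) a q)"

text \<open>One stage, given C = the union of CT+_kappa for kappa < lambda.\<close>
definition PTneg :: "'f signature \<Rightarrow> ('f, 'v, 'a) lit set \<Rightarrow> ('f, 'v, 'a) lit set" where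
  "PTneg Sig C = {l. closed_lit Sig l \<and> \<not> is_pos l \<and> (\<forall>\<beta> \<in> C. \<not> denies l \<beta>)}"

definition PTpos :: "'f signature \<Rightarrow> ('f, 'v, 'a) rule set \<Rightarrow> ('f, 'v, 'a) lit set
                       \<Rightarrow> ('f, 'v, 'a) lit set" where
  "PTpos Sig R C = {\<beta>. closed_lit Sig \<beta> \<and> is_pos \<beta> \<and> proves Sig R (PTneg Sig C) \<beta>}"

definition CTneg :: "'f signature \<Rightarrow> ('f, 'v, 'a) rule set \<Rightarrow> ('f, 'v, 'a) lit set
                       \<Rightarrow> ('f, 'v, 'a) lit set" where
  "CTneg Sig R C = {l. closed_lit Sig l \<and> \<not> is_pos l \<and> (\<forall>\<beta> \<in> PTpos Sig R C. \<not> denies l \<beta>)}"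

definition CTpos :: "'f signature \<Rightarrow> ('f, 'v, 'a) rule set \<Rightarrow> ('f, 'v, 'a) lit set
                       \<Rightarrow> ('f, 'v, 'a) lit set" where
  "CTpos Sig R C = {\<beta>. closed_lit Sig \<beta> \<and> is_pos \<beta> \<and> proves Sig R (CTneg Sig R C) \<beta>}"

text \<open>Ordinals are represented by the elements of a well-order long enough for
  the (monotone) stages to stabilise: the successor cardinal of the set of all
  literals.\<close>
definition wfs_ord :: "('f, 'v, 'a) lit set rel" where
  "wfs_ord = cardSuc (card_of (UNIV :: ('f, 'v, 'a) lit set))"

definition CT_stage :: "'f signature \<Rightarrow> ('f, 'v, 'a) rule set \<Rightarrow> ('f, 'v, 'a) lit set
                          \<Rightarrow> ('f, 'v, 'a) lit set" where
  "CT_stage Sig R = wfrec (wfs_ord - Id)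
      (\<lambda>rec i. CTpos Sig R (\<Union>j \<in> underS wfs_ord i. rec j))"

definition PT_stage :: "'f signature \<Rightarrow> ('f, 'v, 'a) rule set \<Rightarrow> ('f, 'v, 'a) lit set
                          \<Rightarrow> ('f, 'v, 'a) lit set" where
  "PT_stage Sig R i = PTpos Sig R (\<Union>j \<in> underS wfs_ord i. CT_stage Sig R j)"

text \<open>The stable values: CT+ increases and PT+ decreases along the stages.\<close>
definition CTplus :: "'f signature \<Rightarrow> ('f, 'v, 'a) rule set \<Rightarrow> ('f, 'v, 'a) lit set" where
  "CTplus Sig R = (\<Union>i \<in> Field wfs_ord. CT_stage Sig R i)"

definition PTplus :: "'f signature \<Rightarrow> ('f, 'v, 'a) rule set \<Rightarrow> ('f, 'v, 'a) lit set" where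
  "PTplus Sig R = (\<Inter>i \<in> Field wfs_ord. PT_stage Sig R i)"

definition ct_trans :: "'f signature \<Rightarrow> ('f, 'v, 'a) rule set \<Rightarrow> ('f, 'v) rterm \<Rightarrow> 'a
                          \<Rightarrow> ('f, 'v) rterm \<Rightarrow> bool" where
  "ct_trans Sig R p a q \<longleftrightarrow> Trans p a q \<in> CTplus Sig R"

definition pt_trans :: "'f signature \<Rightarrow> ('f, 'v, 'a) rule set \<Rightarrow> ('f, 'v) rterm \<Rightarrow> 'a
                          \<Rightarrow> ('f, 'v) rterm \<Rightarrow> bool" where
  "pt_trans Sig R p a q \<longleftrightarrow> Trans p a q \<in> PTplus Sig R"

definition bisimulation :: "'f signature \<Rightarrow> ('f, 'v, 'a) rule set
                              \<Rightarrow> (('f, 'v) rterm \<times> ('f, 'v) rterm) set \<Rightarrow> bool" where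
  "bisimulation Sig R Rel \<longleftrightarrow>
     (\<forall>(p, q) \<in> Rel. closed Sig p \<and> closed Sig q) \<and>
     (\<forall>(p, q) \<in> Rel.
        (\<forall>a p'. ct_trans Sig R p a p' \<longrightarrow> (\<exists>q'. ct_trans Sig R q a q' \<and> (p', q') \<in> Rel)) \<and>
        (\<forall>a q'. pt_trans Sig R q a q' \<longrightarrow> (\<exists>p'. pt_trans Sig R p a p' \<and> (p', q') \<in> Rel)))"

definition bisim_pre :: "'f signature \<Rightarrow> ('f, 'v, 'a) rule set
                          \<Rightarrow> ('f, 'v) rterm \<Rightarrow> ('f, 'v) rterm \<Rightarrow> bool" where
  "bisim_pre Sig R p q \<longleftrightarrow> (\<exists>Rel. bisimulation Sig R Rel \<and> (p, q) \<in> Rel)"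

fun source :: "('f, 'v, 'a) lit \<Rightarrow> ('f, 'v) rterm" where
  "source (Trans t a u) = t"
| "source (NoTrans t a) = t"

definition ntytt :: "('f, 'v, 'a) rule \<Rightarrow> bool" where
  "ntytt r \<longleftrightarrow> (case r of (H, c) \<Rightarrow>
     is_pos c \<and>
     (\<forall>l \<in> H. is_pos l \<longrightarrow> (\<exists>t a y. l = Trans t a (Var y) \<and> y \<notin> fv (source c))) \<and>
     (\<forall>t a y t' a'. Trans t a (Var y) \<in> H \<longrightarrow> Trans t' a' (Var y) \<in> H \<longrightarrow> t = t' \<and> a = a'))"

definition ntyxt :: "('f, 'v, 'a) rule \<Rightarrow> bool" where
  "ntyxt r \<longleftrightarrow> ntytt r \<and> (\<exists>x. source (snd r) = Var x)"

definition ntyft :: "'f signature \<Rightarrow> ('f, 'v, 'a) rule \<Rightarrow> bool" where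
  "ntyft Sig r \<longleftrightarrow> ntytt r \<and>
     (\<exists>f xs. (f, length xs) \<in> Sig \<and> distinct xs \<and> source (snd r) = Fn f (map Var xs))"

text \<open>P = (Sig, R_rec \<union> R) is in ntyft/ntyxt format with recursion, where R_rec are
  the recursion rules (built into proves) and R are the remaining rules.\<close>
definition ntyft_ntyxt_rec :: "'f signature \<Rightarrow> ('f, 'v, 'a) rule set \<Rightarrow> bool" where
  "ntyft_ntyxt_rec Sig R \<longleftrightarrow> tss Sig R \<and> (\<forall>r \<in> R. ntyft Sig r \<or> ntyxt r)"

end

theory Submission
  imports Defs
begin

text \<open>
  To show that \<open>t[\<rho>]\<close> and \<open>t[\<nu>]\<close> are related, replace each \<open>x\<close> in \<open>t\<close> by a new constant
  that stands for the pair \<open>(\<rho> x, \<nu> x)\<close>. Such a marked term has a left and a right projection,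
  and the pairs of projections of marked terms form a bisimulation. The point is that a proof of a
  transition from the left projection \<open>p\<close> of a marked term \<open>m\<close> to \<open>q\<close> can be replayed on the
  right, ending in the right projection of some marked term over \<open>q\<close>.

  The format does not require rules to be well-founded: a premise \<open>t \<rightarrow> y\<close> may have \<open>y\<close> in \<open>t\<close>, so
  the marked versions of the values of the variables \<open>y\<close> cannot be chosen one after the other.
  Instead, the marked terms over a fixed closed \<open>p\<close> are made into a complete lattice, each proof
  of a transition from \<open>p\<close> to \<open>q\<close> is turned into a monotone map from the lattice over \<open>p\<close> to that
  over \<open>q\<close>, and circular premises are solved by a least fixed point (Knaster-Tarski).

  For the well-founded semantics, write \<open>C\<close> for a stage of the certain transitions. Certain
  transitions in \<open>C\<close> being simulated from left to right allows possible transitions to be simulated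
  from right to left into the possible transitions computed from \<open>C\<close>, which in turn gives the
  simulation of the next stage of certain transitions.
\<close>

section \<open>Terms and substitution\<close>

text \<open>The rule generated by the datatype states the hypothesis for \<open>Rec\<close> through
  ranges and option sets; here it concerns the entries \<open>S Y = Some t\<close>, the form used by
  the inductions below.\<close>

lemma rterm_induct [case_names Var Fn Rec]:
  assumes "\<And>x. P (Var x)"
    and "\<And>f ts. (\<And>t. t \<in> set ts \<Longrightarrow> P t) \<Longrightarrow> P (Fn f ts)"
    and "\<And>X S. (\<And>Y t. S Y = Some t \<Longrightarrow> P t) \<Longrightarrow> P (Rec X S)"
  shows "P t"
proof (induction t)
  case (Rec X S)
  then show ?case
    by (metis assms(3) option.set_intros rangeI)
qed (use assms in auto)

lemma wf_term_Rec [simp]: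
  "wf_term Sig (Rec X S) \<longleftrightarrow> X \<in> dom S \<and> (\<forall>Y t. S Y = Some t \<longrightarrow> wf_term Sig t)"
  by (auto simp: ran_def)

lemma fv_Rec [simp]: "fv (Rec X S) = {x. x \<notin> dom S \<and> (\<exists>Y t. S Y = Some t \<and> x \<in> fv t)}"
  by (auto simp: ran_def; metis)

declare wf_term.simps(3) [simp del] fv.simps(3) [simp del]

lemma dom_eqE:
  assumes "dom S = dom S'"
  obtains "S Y = None" "S' Y = None" | a b where "S Y = Some a" "S' Y = Some b"
  using assms by (metis domIff option.exhaust)

lemma subst_aux_cong:
  assumes "\<And>x. x \<in> fv t \<Longrightarrow> \<sigma> x = \<tau> x"
  shows "subst_aux t \<sigma> = subst_aux t \<tau>"
  using assms
proof (induction t arbitrary: \<sigma> \<tau> rule: rterm_induct)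
  case (Fn f ts)
  have "subst_aux t \<sigma> = subst_aux t \<tau>" if "t \<in> set ts" for t
    by (rule Fn.IH) (use that Fn.prems in auto)
  then show ?case by simp
next
  case (Rec X S)
  show ?case
  proof (simp, rule ext)
    fix Y
    show "(map_option (\<lambda>u. subst_aux u (\<lambda>Z. if Z \<in> dom S then Var Z else \<sigma> Z)) \<circ> S) Y =
      (map_option (\<lambda>u. subst_aux u (\<lambda>Z. if Z \<in> dom S then Var Z else \<tau> Z)) \<circ> S) Y"
      using Rec.prems by (cases "S Y") (force intro!: Rec.IH)+
  qed
qed simp

lemma subst_aux_Var [simp]: "subst_aux t Var = t"
proof (induction t rule: rterm_induct)
  case (Rec X S)
  have "map_option (\<lambda>u. subst_aux u Var) (S Y) = S Y" for Y
    using Rec by (cases "S Y") auto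
  then show ?case by (auto simp: fun_eq_iff)
qed (auto intro: map_idI)

lemma subst_aux_closed:
  assumes "fv t = {}"
  shows "subst_aux t \<sigma> = t"
  using subst_aux_cong[of t \<sigma> Var] assms by simp

lemma wf_term_subst_aux:
  assumes "wf_term Sig t" and "\<And>x. wf_term Sig (\<sigma> x)"
  shows "wf_term Sig (subst_aux t \<sigma>)"
  using assms
proof (induction t arbitrary: \<sigma> rule: rterm_induct)
  case (Rec X S)
  then show ?case by (auto intro!: Rec.IH)
qed (auto simp: list_all_iff)

lemma fv_subst_aux: "fv (subst_aux t \<sigma>) \<subseteq> (\<Union>x \<in> fv t. fv (\<sigma> x))"
proof (induction t arbitrary: \<sigma> rule: rterm_induct)
  case (Rec X S)
  show ?case
  proof
    fix z
    assume "z \<in> fv (subst_aux (Rec X S) \<sigma>)"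
    then obtain Y t where *: "S Y = Some t" "z \<notin> dom S"
      "z \<in> fv (subst_aux t (\<lambda>Z. if Z \<in> dom S then Var Z else \<sigma> Z))"
      by auto
    with Rec.IH[OF *(1)] obtain x where
      "x \<in> fv t" "z \<in> fv (if x \<in> dom S then Var x else \<sigma> x)" by fast
    with *(1,2) show "z \<in> (\<Union>x \<in> fv (Rec X S). fv (\<sigma> x))"
      by (auto split: if_splits)
  qed
qed (simp, fastforce)

lemma closed_subst_aux:
  assumes "wf_term Sig t" and "closed_subst Sig \<sigma>"
  shows "closed Sig (subst_aux t \<sigma>)"
  using assms wf_term_subst_aux[of Sig t \<sigma>] fv_subst_aux[of t \<sigma>]
  by (auto simp: closed_def closed_subst_def)

section \<open>Marked terms\<close>

primrec proj :: "('c \<Rightarrow> ('f, 'v) rterm) \<Rightarrow> ('f + 'c, 'v) rterm \<Rightarrow> ('f, 'v) rterm" where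
  "proj g (Var x) = Var x"
| "proj g (Fn h ts) = (case h of Inl f \<Rightarrow> Fn f (map (proj g) ts) | Inr c \<Rightarrow> g c)"
| "proj g (Rec X S) = Rec X (map_option (proj g) \<circ> S)"

definition ext_sig :: "'f signature \<Rightarrow> 'c set \<Rightarrow> ('f + 'c) signature" where
  "ext_sig Sig T = map_prod Inl id ` Sig \<union> (\<lambda>c. (Inr c, 0)) ` T"

lemma ext_sig_simps [simp]:
  "(Inl f, n) \<in> ext_sig Sig T \<longleftrightarrow> (f, n) \<in> Sig"
  "(Inr c, n) \<in> ext_sig Sig T \<longleftrightarrow> c \<in> T \<and> n = 0"
  by (force simp: ext_sig_def)+

section \<open>Embedded ordinary terms and projections of marked terms\<close>

abbreviation emb :: "('f, 'v) rterm \<Rightarrow> ('f + 'c, 'v) rterm" where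
  "emb \<equiv> map_rterm Inl"

lemma wf_term_emb [simp]: "wf_term (ext_sig Sig T) (emb t) \<longleftrightarrow> wf_term Sig t"
  by (induction t rule: rterm_induct) (auto simp: list_all_iff, metis)

lemma fv_emb [simp]: "fv (emb t) = fv t"
  by (induction t rule: rterm_induct) (auto, metis+)

lemma proj_emb [simp]: "proj g (emb t) = t"
proof (induction t rule: rterm_induct)
  case (Rec X S)
  have "map_option (proj g) (map_option emb (S Y)) = S Y" for Y
    using Rec by (cases "S Y") auto
  then show ?case by (simp add: fun_eq_iff)
qed (auto intro: map_idI)

lemma wf_term_proj:
  assumes "wf_term (ext_sig Sig T) m" and "\<And>c. c \<in> T \<Longrightarrow> closed Sig (g c)"
  shows "wf_term Sig (proj g m)"
  using assms(1)
  by (induction m rule: rterm_induct)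
    (auto simp: list_all_iff assms(2)[unfolded closed_def] split: sum.split)

lemma fv_proj:
  assumes "wf_term (ext_sig Sig T) m" and "\<And>c. c \<in> T \<Longrightarrow> closed Sig (g c)"
  shows "fv (proj g m) = fv m"
  using assms(1)
proof (induction m rule: rterm_induct)
  case (Rec X S)
  then have "(\<exists>t. map_option (proj g) (S Y) = Some t \<and> x \<in> fv t) \<longleftrightarrow> (\<exists>t. S Y = Some t \<and> x \<in> fv t)" for x Y
    by auto
  then show ?case by (simp add: dom_def)
qed (auto simp: list_all_iff assms(2)[unfolded closed_def] split: sum.split)

lemma closed_proj:
  assumes "closed (ext_sig Sig T) m" and "\<And>c. c \<in> T \<Longrightarrow> closed Sig (g c)"
  shows "closed Sig (proj g m)"
  using assms fv_proj[of Sig T m g] wf_term_proj[of Sig T m g] by (auto simp: closed_def)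

text \<open>The critical case is a constant: its value \<open>g c\<close> is closed, so the
  substitution that meets it after projection has no effect.\<close>

lemma proj_subst_aux:
  assumes "wf_term (ext_sig Sig T) m" and "\<And>c. c \<in> T \<Longrightarrow> closed Sig (g c)"
  shows "proj g (subst_aux m \<sigma>) = subst_aux (proj g m) (proj g \<circ> \<sigma>)"
  using assms(1)
proof (induction m arbitrary: \<sigma> rule: rterm_induct)
  case (Fn h ts)
  then show ?case
    by (auto simp: list_all_iff assms(2)[unfolded closed_def] subst_aux_closed split: sum.split)
next
  case (Rec X S)
  have "map_option (proj g) (map_option (\<lambda>u. subst_aux u (\<lambda>Z. if Z \<in> dom S then Var Z else \<sigma> Z)) (S Y)) =
      map_option (\<lambda>u. subst_aux u (\<lambda>Z. if Z \<in> dom S then Var Z else proj g (\<sigma> Z)))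
        (map_option (proj g) (S Y))" for Y
    using Rec.IH Rec.prems by (cases "S Y") (auto intro!: subst_aux_cong)
  then show ?case by (simp add: fun_eq_iff)
qed simp

lemma proj_subst_emb:
  assumes "wf_term Sig t"
  shows "proj g (subst_aux (emb t) s) = subst_aux t (proj g \<circ> s)"
  using assms proj_subst_aux[of Sig "{}" "emb t" g s] by simp

text \<open>\<open>Known k\<close> is the constant for a pair of related terms. \<open>Bot p\<close> and \<open>Top p\<close> stand for \<open>p\<close>
  in both projections; they serve only as the least and greatest marked terms over \<open>p\<close>.\<close>

datatype ('t, 'k) token = Bot 't | Top 't | Known 'k

primrec token_val :: "('k \<Rightarrow> 't) \<Rightarrow> ('t, 'k) token \<Rightarrow> 't" where
  "token_val l (Bot p) = p"
| "token_val l (Top p) = p"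
| "token_val l (Known k) = l k"

definition tokens :: "'f signature \<Rightarrow> 'k set \<Rightarrow> (('f, 'v) rterm, 'k) token set" where
  "tokens Sig K = Bot ` Collect (closed Sig) \<union> Top ` Collect (closed Sig) \<union> Known ` K"

lemma tokens_simps [simp]:
  "Bot p \<in> tokens Sig K \<longleftrightarrow> closed Sig p"
  "Top p \<in> tokens Sig K \<longleftrightarrow> closed Sig p"
  "Known k \<in> tokens Sig K \<longleftrightarrow> k \<in> K"
  by (auto simp: tokens_def)

abbreviation tok :: "'c \<Rightarrow> ('f + 'c, 'v) rterm" where
  "tok c \<equiv> Fn (Inr c) []"

text \<open>Only one projection is fixed, because the order on marked terms refers to one side
  alone. The two directions of the simulation take \<open>fst\<close> and \<open>snd\<close> for
  \<open>l\<close>.\<close>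

locale marking =
  fixes Sig :: "'f signature" and K :: "'k set" and l :: "'k \<Rightarrow> ('f, 'v) rterm"
  assumes closed_l: "k \<in> K \<Longrightarrow> closed Sig (l k)"
begin

section \<open>The marked terms over a fixed term and their order\<close>

abbreviation wf_marked :: "('f + (('f, 'v) rterm, 'k) token, 'v) rterm \<Rightarrow> bool" where
  "wf_marked \<equiv> wf_term (ext_sig Sig (tokens Sig K))"

abbreviation lproj :: "('f + (('f, 'v) rterm, 'k) token, 'v) rterm \<Rightarrow> ('f, 'v) rterm" where
  "lproj \<equiv> proj (token_val l)"

definition lifts :: "('f, 'v) rterm \<Rightarrow> ('f + (('f, 'v) rterm, 'k) token, 'v) rterm set" where
  "lifts p = {m. wf_marked m \<and> lproj m = p}"

text \<open>The order is generated by the term constructors and by making \<open>Bot p\<close> least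
  and \<open>Top p\<close> greatest over each closed \<open>p\<close>. A token
  \<open>Known k\<close> with \<open>k \<in> K\<close> is comparable only with itself and with the
  \<open>Bot\<close> and \<open>Top\<close> of its value, so no relation between different pairs is
  presupposed.\<close>

inductive le :: "('f + (('f, 'v) rterm, 'k) token, 'v) rterm \<Rightarrow>
    ('f + (('f, 'v) rterm, 'k) token, 'v) rterm \<Rightarrow> bool" (infix "\<preceq>" 50) where
  bot: "closed Sig p \<Longrightarrow> m \<in> lifts p \<Longrightarrow> tok (Bot p) \<preceq> m"
| top: "closed Sig p \<Longrightarrow> m \<in> lifts p \<Longrightarrow> m \<preceq> tok (Top p)"
| var: "Var x \<preceq> Var x"
| fn: "length ms = length ns \<Longrightarrow> (\<And>i. i < length ms \<Longrightarrow> ms ! i \<preceq> ns ! i) \<Longrightarrow> Fn h ms \<preceq> Fn h ns"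
| rec: "dom S = dom S' \<Longrightarrow> (\<And>Y m n. S Y = Some m \<Longrightarrow> S' Y = Some n \<Longrightarrow> m \<preceq> n) \<Longrightarrow>
    Rec X S \<preceq> Rec X S'"

lemma closed_token_val: "c \<in> tokens Sig K \<Longrightarrow> closed Sig (token_val l c)"
  by (cases c) (auto simp: closed_l)

lemma lproj_subst_aux:
  "wf_marked m \<Longrightarrow> lproj (subst_aux m s) = subst_aux (lproj m) (lproj \<circ> s)"
  using closed_token_val by (intro proj_subst_aux) auto

lemma lifts_fv: "m \<in> lifts p \<Longrightarrow> fv m = fv p"
  unfolding lifts_def using fv_proj[of Sig "tokens Sig K" m "token_val l"] closed_token_val by blast

lemma lifts_closed: "closed Sig p \<Longrightarrow> m \<in> lifts p \<Longrightarrow> closed (ext_sig Sig (tokens Sig K)) m"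
  by (simp add: closed_def lifts_fv) (simp add: lifts_def)

lemma tok_in_lifts [simp]:
  "tok (Bot p) \<in> lifts q \<longleftrightarrow> p = q \<and> closed Sig p"
  "tok (Top p) \<in> lifts q \<longleftrightarrow> p = q \<and> closed Sig p"
  "tok (Known k) \<in> lifts q \<longleftrightarrow> l k = q \<and> k \<in> K"
  by (auto simp: lifts_def)

lemma emb_in_lifts: "wf_term Sig p \<Longrightarrow> emb p \<in> lifts p"
  by (simp add: lifts_def)

lemma subst_in_lifts:
  assumes "m \<in> lifts p" and "\<And>x. s x \<in> lifts (\<sigma> x)"
  shows "subst_aux m s \<in> lifts (subst_aux p \<sigma>)"
proof -
  have "lproj \<circ> s = \<sigma>" using assms(2) by (auto simp: lifts_def)
  then show ?thesis
    using assms lproj_subst_aux[of m s] by (auto simp: lifts_def intro!: wf_term_subst_aux)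
qed

lemma lifts_Var: "m \<in> lifts (Var x) \<Longrightarrow> m = Var x"
  using closed_token_val
  by (cases m) (force simp: lifts_def closed_def split: sum.splits)+

text \<open>Projection changes the head of a term only at a token; any other lift decomposes along
  the term it lies over.\<close>

lemma lifts_Fn:
  assumes "m \<in> lifts (Fn f ps)" and "\<nexists>c. m = tok c"
  obtains ms where "m = Fn (Inl f) ms" and "length ms = length ps"
    and "\<And>i. i < length ps \<Longrightarrow> ms ! i \<in> lifts (ps ! i)" and "(f, length ps) \<in> Sig"
  using assms by (cases m) (auto simp: lifts_def list_all_length split: sum.splits)

lemma lifts_Rec:
  assumes "m \<in> lifts (Rec X S)" and "\<nexists>c. m = tok c"
  obtains S' where "m = Rec X S'" and "dom S' = dom S" and "X \<in> dom S"
    and "\<And>Y m p. S' Y = Some m \<Longrightarrow> S Y = Some p \<Longrightarrow> m \<in> lifts p"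
proof -
  obtain S' where S': "m = Rec X S'" "wf_marked (Rec X S')" "S = map_option lproj \<circ> S'"
    using assms by (cases m) (auto simp: lifts_def split: sum.splits)
  show thesis
    by (rule that[of S']) (use S' in \<open>auto simp: lifts_def dom_def\<close>)
qed

lemma Fn_in_lifts:
  assumes "length ms = length ps" and "\<And>i. i < length ps \<Longrightarrow> ms ! i \<in> lifts (ps ! i)"
    and "(f, length ps) \<in> Sig"
  shows "Fn (Inl f) ms \<in> lifts (Fn f ps)"
  using assms by (auto simp: lifts_def list_all_length intro: nth_equalityI)

lemma Rec_in_lifts:
  assumes "dom S' = dom S" and "\<And>Y m p. S' Y = Some m \<Longrightarrow> S Y = Some p \<Longrightarrow> m \<in> lifts p"
    and "X \<in> dom S"
  shows "Rec X S' \<in> lifts (Rec X S)"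
proof -
  have "map_option lproj (S' Y) = S Y" for Y
    using assms(1) by (rule dom_eqE[where Y = Y]) (use assms(2) in \<open>auto simp: lifts_def\<close>)
  then have "map_option lproj \<circ> S' = S" by auto
  moreover have "wf_marked m" if "S' Y = Some m" for Y m
    using assms(1,2) that by (metis (mono_tags) domD domI lifts_def mem_Collect_eq)
  ultimately show ?thesis using assms by (auto simp: lifts_def)
qed

lemma token_le_iff: "tok c \<preceq> m \<longleftrightarrow> m = tok c \<or>
    (\<exists>p. c = Bot p \<and> closed Sig p \<and> m \<in> lifts p) \<or>
    (m = tok (Top (token_val l c)) \<and> c \<in> tokens Sig K)"
  using closed_token_val
  by (auto elim: le.cases intro: le.intros simp: lifts_def)

lemma le_token_iff: "m \<preceq> tok c \<longleftrightarrow> m = tok c \<or>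
    (\<exists>p. c = Top p \<and> closed Sig p \<and> m \<in> lifts p) \<or>
    (m = tok (Bot (token_val l c)) \<and> c \<in> tokens Sig K)"
  using closed_token_val
  by (auto elim: le.cases intro: le.intros simp: lifts_def)

lemma le_refl: "m \<preceq> m"
  by (induction m rule: rterm_induct) (auto intro!: le.fn le.rec le.var)

lemma le_antisym: "m \<preceq> n \<Longrightarrow> n \<preceq> m \<Longrightarrow> m = n"
proof (induction rule: le.induct)
  case (fn ms ns h)
  from fn.prems show ?case
    by cases (use fn in \<open>auto simp: token_le_iff le_token_iff intro: nth_equalityI\<close>)
next
  case (rec S S' X)
  from rec.prems have *: "n \<preceq> m" if "S Y = Some m" "S' Y = Some n" for Y m n
    by cases (use that in auto)
  have "S Y = S' Y" for Y
    using rec.hyps(1) by (rule dom_eqE[where Y = Y]) (use rec.IH * in auto)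
  then show ?case by auto
qed (auto simp: token_le_iff le_token_iff)

text \<open>In each generating case both sides erase to the same term, so the order splits into the
  fibres \<open>lifts p\<close>.\<close>

lemma le_wf_lproj: "m \<preceq> n \<Longrightarrow> (wf_marked m \<longleftrightarrow> wf_marked n) \<and> lproj m = lproj n"
proof (induction rule: le.induct)
  case (fn ms ns h)
  then have "map lproj ms = map lproj ns" by (auto intro: nth_equalityI)
  with fn show ?case by (auto simp: list_all_length split: sum.split)
next
  case (rec S S' X)
  have "(\<forall>m. S Y = Some m \<longrightarrow> wf_marked m) \<longleftrightarrow> (\<forall>n. S' Y = Some n \<longrightarrow> wf_marked n)"
    "map_option lproj (S Y) = map_option lproj (S' Y)" for Y
    using rec.hyps(1) by (rule dom_eqE[where Y = Y]; use rec.IH in auto)+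
  then show ?case using rec.hyps by (simp add: fun_eq_iff)
qed (auto simp: lifts_def)

lemma le_lifts: "m \<preceq> n \<Longrightarrow> m \<in> lifts p \<longleftrightarrow> n \<in> lifts p"
  using le_wf_lproj by (auto simp: lifts_def)

lemma le_trans: "m \<preceq> n \<Longrightarrow> n \<preceq> k \<Longrightarrow> m \<preceq> k"
proof (induction arbitrary: k rule: le.induct)
  case (bot p m)
  then show ?case using le_lifts le.bot by blast
next
  case (top p m)
  then have "k = tok (Top p)" by (auto simp: token_le_iff)
  with top show ?case using le.top by blast
next
  case (fn ms ns h)
  from fn.prems show ?case
  proof cases
    case (bot p)
    with fn show ?thesis by (auto intro: le.bot)
  next
    case (top p)
    moreover have "Fn h ms \<preceq> Fn h ns" using fn.hyps by (rule le.fn)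
    ultimately show ?thesis using le_lifts le.top by blast
  next
    case (fn ks)
    with fn.hyps fn.IH show ?thesis by (auto intro!: le.fn)
  qed
next
  case (rec S S' X)
  from rec.prems show ?case
  proof cases
    case (top p)
    moreover have "Rec X S \<preceq> Rec X S'" using rec.hyps by (rule le.rec)
    ultimately show ?thesis using le_lifts le.top by blast
  next
    case (rec S'')
    show ?thesis unfolding rec(1)
    proof (rule le.rec)
      fix Y m n
      assume "S Y = Some m" "S'' Y = Some n"
      moreover then obtain m' where "S' Y = Some m'" using rec.hyps by blast
      ultimately show "m \<preceq> n" using rec(3) rec.IH by blast
    qed (use rec rec.hyps in simp)
  qed
qed auto

text \<open>A lift of a closed term is itself closed and thus fixed by every substitution, which
  settles \<open>bot\<close> and \<open>top\<close>. Under a binder the bound variables are sent to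
  themselves, where \<open>le.var\<close> applies.\<close>

lemma le_subst_aux:
  assumes "m \<preceq> n" and "\<And>x. s x \<preceq> s' x"
  shows "subst_aux m s \<preceq> subst_aux n s'"
  using assms
proof (induction arbitrary: s s' rule: le.induct)
  case (bot p m)
  then have "subst_aux m s' \<in> lifts p"
    using lifts_fv[of m p] by (simp add: subst_aux_closed closed_def)
  with bot show ?case by (auto intro: le.bot)
next
  case (top p m)
  then have "subst_aux m s \<in> lifts p"
    using lifts_fv[of m p] by (simp add: subst_aux_closed closed_def)
  with top show ?case by (auto intro: le.top)
next
  case (rec S S' X)
  have "subst_aux m (\<lambda>Z. if Z \<in> dom S then Var Z else s Z) \<preceq>
      subst_aux n (\<lambda>Z. if Z \<in> dom S' then Var Z else s' Z)"
    if "S Y = Some m" "S' Y = Some n" for Y m n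
    by (rule rec.IH[OF that]) (use rec in \<open>auto intro: le.var\<close>)
  then show ?case
    using rec.hyps(1) by simp (rule le.rec, simp, auto)
qed (auto intro: le.fn)

section \<open>Greatest lower bounds over a fixed term\<close>

definition is_glb where
  "is_glb g B \<longleftrightarrow> (\<forall>m \<in> B. g \<preceq> m) \<and> (\<forall>h. (\<forall>m \<in> B. h \<preceq> m) \<longrightarrow> h \<preceq> g)"

text \<open>Reduction to sets without tokens. \<open>Top p\<close> can be discarded, as it lies
  above all other lifts. A single remaining token is its own meet. A token other than
  \<open>Top p\<close> together with a different remaining element has nothing but
  \<open>Bot p\<close> below both.\<close>

lemma glb_if_structural_glb:
  assumes "B \<subseteq> lifts p" and "B \<noteq> {}"
    and str: "\<And>B'. B' \<subseteq> lifts p \<Longrightarrow> B' \<noteq> {} \<Longrightarrow> \<forall>m \<in> B'. \<nexists>c. m = tok c \<Longrightarrow> \<exists>g \<in> lifts p. is_glb g B'"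
  shows "\<exists>g \<in> lifts p. is_glb g B"
proof -
  define B' where "B' = B - {tok (Top p)}"
  have top: "g \<preceq> m" if "m \<in> B - B'" "g \<in> lifts p" for g m
  proof -
    have "m = tok (Top p)" "closed Sig p" using that assms(1) by (auto simp: B'_def)
    with that show ?thesis by (auto intro: le.top)
  qed
  consider "B' = {}" | "B' \<noteq> {}" "\<forall>m \<in> B'. \<nexists>c. m = tok c"
    | c where "tok c \<in> B'" "B' \<subseteq> {tok c}"
    | c m where "tok c \<in> B'" "m \<in> B'" "m \<noteq> tok c"
    by fast
  then show ?thesis
  proof cases
    case 1
    then have "B = {tok (Top p)}" using assms(2) by (auto simp: B'_def)
    then show ?thesis using assms(1) by (intro bexI[of _ "tok (Top p)"]) (auto simp: is_glb_def le_refl)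
  next
    case 2
    then obtain g where g: "g \<in> lifts p" "is_glb g B'"
      using str[of B'] assms(1) unfolding B'_def by blast
    have "is_glb g B"
      unfolding is_glb_def
    proof (intro conjI ballI allI impI)
      fix m assume "m \<in> B"
      then show "g \<preceq> m" using g top by (cases "m \<in> B'") (auto simp: is_glb_def)
    next
      fix h assume "\<forall>m \<in> B. h \<preceq> m"
      then show "h \<preceq> g" using g by (auto simp: is_glb_def B'_def)
    qed
    with g show ?thesis by blast
  next
    case 3
    then have c: "tok c \<in> lifts p" "tok c \<in> B" using assms(1) by (auto simp: B'_def)
    have "tok c \<preceq> m" if "m \<in> B" for m
      using 3 that c top[of m "tok c"] le_refl[of "tok c"] by (cases "m \<in> B'") auto
    with c show ?thesis by (auto simp: is_glb_def)
  next
    case 4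
    then have c: "tok c \<in> lifts p" "tok c \<in> B" "m \<in> B" "c \<noteq> Top p" "m \<noteq> tok (Top p)"
      using assms(1) by (auto simp: B'_def)
    then have p: "c \<in> tokens Sig K" "token_val l c = p" "closed Sig p"
      using closed_token_val by (auto simp: lifts_def)
    have "h \<preceq> tok (Bot p)" if "\<forall>m \<in> B. h \<preceq> m" for h
    proof -
      have h: "h \<preceq> tok c" "h \<preceq> m" using that c by auto
      from h(1) consider "h = tok c" | "h = tok (Bot p)"
        using c(4) p unfolding le_token_iff by auto
      then show ?thesis
      proof cases
        case 1
        have "tok c \<preceq> m" using h(2) 1 by simp
        then obtain p' where "c = Bot p'" using 4(3) c(5) p(2) unfolding token_le_iff by blast
        then have "c = Bot p" using p(2) by simp
        with 1 show ?thesis by (simp add: le_refl)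
      qed (simp add: le_refl)
    qed
    moreover have "tok (Bot p) \<preceq> m" if "m \<in> B" for m
      using that p assms(1) by (auto intro: le.bot)
    ultimately show ?thesis
      using p by (intro bexI[of _ "tok (Bot p)"]) (auto simp: is_glb_def)
  qed
qed

text \<open>Without tokens all elements share the head of \<open>p\<close>, so meets are formed
  componentwise. The induction cannot assume \<open>p\<close> closed: it descends into the bodies of
  recursive specifications, where bound variables occur free.\<close>

lemma lifts_glb_nonempty:
  assumes "B \<subseteq> lifts p" and "B \<noteq> {}"
  shows "\<exists>g \<in> lifts p. is_glb g B"
  using assms
proof (induction p arbitrary: B rule: rterm_induct)
  case (Var x)
  then have "B = {Var x}" using lifts_Var by blast
  with Var show ?case by (intro bexI[of _ "Var x"]) (auto simp: is_glb_def le_refl)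
next
  case (Fn f ps)
  show ?case
  proof (rule glb_if_structural_glb[OF Fn.prems])
    fix B
    assume B: "B \<subseteq> lifts (Fn f ps)" "B \<noteq> {}" "\<forall>m \<in> B. \<nexists>c. m = tok c"
    have form: "\<exists>ms. m = Fn (Inl f) ms \<and> length ms = length ps \<and>
        (\<forall>i < length ps. ms ! i \<in> lifts (ps ! i)) \<and> (f, length ps) \<in> Sig"
      if "m \<in> B" for m
    proof -
      have "m \<in> lifts (Fn f ps)" "\<nexists>c. m = tok c" using that B by auto
      then show ?thesis by (rule lifts_Fn) blast
    qed
    define C where "C i = {ms ! i | ms. Fn (Inl f) ms \<in> B}" for i
    have "\<exists>g \<in> lifts (ps ! i). is_glb g (C i)" if "i < length ps" for i
    proof (rule Fn.IH)
      show "C i \<subseteq> lifts (ps ! i)" unfolding C_def using form that by blast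
      obtain m where "m \<in> B" using B(2) by blast
      with form show "C i \<noteq> {}" unfolding C_def by blast
    qed (use that in simp)
    then obtain g where g: "\<And>i. i < length ps \<Longrightarrow> g i \<in> lifts (ps ! i)"
      "\<And>i. i < length ps \<Longrightarrow> is_glb (g i) (C i)" by metis
    let ?g = "Fn (Inl f) (map g [0..<length ps])"
    have "?g \<in> lifts (Fn f ps)"
      using g(1) form B(2) by (intro Fn_in_lifts) auto
    moreover have "is_glb ?g B"
      unfolding is_glb_def
    proof (intro conjI ballI allI impI)
      fix m assume "m \<in> B"
      with form obtain ms where ms: "m = Fn (Inl f) ms" "length ms = length ps" by blast
      have "g i \<preceq> ms ! i" if "i < length ps" for i
        using g(2)[OF that] \<open>m \<in> B\<close> ms(1) unfolding is_glb_def C_def by blast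
      with ms show "?g \<preceq> m" by (auto intro!: le.fn)
    next
      fix h assume h: "\<forall>m \<in> B. h \<preceq> m"
      obtain m ms where m: "m \<in> B" "m = Fn (Inl f) ms" "length ms = length ps"
        using B(2) form by blast
      have "h \<preceq> Fn (Inl f) ms" using h m by blast
      then show "h \<preceq> ?g"
      proof cases
        \<comment> \<open>Here \<open>h\<close> is the \<open>Bot\<close> of \<open>Fn f ps\<close>,
          which also lies below the candidate meet.\<close>
        case (bot p)
        then show ?thesis
          using \<open>?g \<in> _\<close> m B(1) by (auto intro!: le.bot simp: lifts_def)
      next
        case (fn hs)
        have "hs ! i \<preceq> g i" if i: "i < length ps" for i
        proof -
          have "hs ! i \<preceq> n" if n: "n \<in> C i" for n
          proof -
            obtain ns where ns: "n = ns ! i" "Fn (Inl f) ns \<in> B" using n by (auto simp: C_def)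
            have "Fn (Inl f) hs \<preceq> Fn (Inl f) ns" using ns h fn by blast
            then show ?thesis by cases (use i m fn ns in auto)
          qed
          then show ?thesis using g(2)[OF i] by (auto simp: is_glb_def)
        qed
        with fn m show ?thesis by (auto intro!: le.fn)
      qed
    qed
    ultimately show "\<exists>g \<in> lifts (Fn f ps). is_glb g B" by blast
  qed
next
  case (Rec X S)
  show ?case
  proof (rule glb_if_structural_glb[OF Rec.prems])
    fix B
    assume B: "B \<subseteq> lifts (Rec X S)" "B \<noteq> {}" "\<forall>m \<in> B. \<nexists>c. m = tok c"
    have form: "\<exists>S'. m = Rec X S' \<and> dom S' = dom S \<and> X \<in> dom S \<and>
        (\<forall>Y m p. S' Y = Some m \<longrightarrow> S Y = Some p \<longrightarrow> m \<in> lifts p)"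
      if "m \<in> B" for m
    proof -
      have "m \<in> lifts (Rec X S)" "\<nexists>c. m = tok c" using that B by auto
      then show ?thesis by (rule lifts_Rec) blast
    qed
    define C where "C Y = {m. \<exists>S'. Rec X S' \<in> B \<and> S' Y = Some m}" for Y
    have "\<exists>g \<in> lifts p. is_glb g (C Y)" if "S Y = Some p" for Y p
    proof (rule Rec.IH[OF that])
      show "C Y \<subseteq> lifts p" unfolding C_def using form that by blast
      obtain S' where "Rec X S' \<in> B" "dom S' = dom S" using B(2) form by blast
      with that show "C Y \<noteq> {}" unfolding C_def by blast
    qed
    then have "\<forall>Y. \<exists>g. \<forall>p. S Y = Some p \<longrightarrow> g \<in> lifts p \<and> is_glb g (C Y)"
      by (metis option.inject)
    then obtain g where g: "\<And>Y p. S Y = Some p \<Longrightarrow> g Y \<in> lifts p \<and> is_glb (g Y) (C Y)"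
      by metis
    define G where "G Y = (if Y \<in> dom S then Some (g Y) else None)" for Y
    have dom_G: "dom G = dom S" by (auto simp: G_def split: if_splits)
    have "Rec X G \<in> lifts (Rec X S)"
      using g form B(2) dom_G by (intro Rec_in_lifts) (auto simp: G_def split: if_splits)
    moreover have "is_glb (Rec X G) B"
      unfolding is_glb_def
    proof (intro conjI ballI allI impI)
      fix m assume "m \<in> B"
      with form obtain S' where S': "m = Rec X S'" "dom S' = dom S" by blast
      show "Rec X G \<preceq> m"
        unfolding S'(1)
      proof (rule le.rec)
        fix Y m' n
        assume Y: "G Y = Some m'" "S' Y = Some n"
        then obtain p where "S Y = Some p" using dom_G by blast
        then have "m' = g Y" "is_glb (g Y) (C Y)" using g Y(1) by (auto simp: G_def domIff)
        moreover have "n \<in> C Y" using Y \<open>m \<in> B\<close> S'(1) unfolding C_def by blast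
        ultimately show "m' \<preceq> n" by (simp add: is_glb_def)
      qed (simp add: dom_G S')
    next
      fix h assume h: "\<forall>m \<in> B. h \<preceq> m"
      obtain m where "m \<in> B" using B(2) by blast
      moreover obtain S' where "m = Rec X S'" "dom S' = dom S" using form[OF \<open>m \<in> B\<close>] by blast
      ultimately have m: "m \<in> B" "m = Rec X S'" "dom S' = dom S" by simp_all
      have "h \<preceq> Rec X S'" using h m by blast
      then show "h \<preceq> Rec X G"
      proof cases
        case (bot p)
        then show ?thesis
          using \<open>Rec X G \<in> _\<close> m B(1) by (auto intro!: le.bot simp: lifts_def)
      next
        case (rec T)
        show ?thesis unfolding rec(1)
        proof (rule le.rec)
          fix Y t n
          assume Y: "T Y = Some t" "G Y = Some n"
          then obtain p where p: "S Y = Some p" using dom_G by blast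
          have "t \<preceq> n'" if n': "n' \<in> C Y" for n'
          proof -
            obtain S'' where S'': "Rec X S'' \<in> B" "S'' Y = Some n'" using n' by (auto simp: C_def)
            have "Rec X T \<preceq> Rec X S''" using S'' h rec by blast
            then show ?thesis by cases (use Y S'' in auto)
          qed
          then show "t \<preceq> n" using g[OF p] p Y by (auto simp: is_glb_def G_def split: if_splits)
        qed (use rec m dom_G in simp)
      qed
    qed
    ultimately show "\<exists>g \<in> lifts (Rec X S). is_glb g B" by blast
  qed
qed

text \<open>Completeness in the form needed for Knaster-Tarski: bounds are compared within the fibre
  only, so that \<open>tok (Top p)\<close> can be the meet of the empty set.\<close>

lemma lifts_glb:
  assumes "B \<subseteq> lifts p" and "closed Sig p"
  shows "\<exists>g \<in> lifts p. (\<forall>m \<in> B. g \<preceq> m) \<and> (\<forall>h \<in> lifts p. (\<forall>m \<in> B. h \<preceq> m) \<longrightarrow> h \<preceq> g)"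
proof (cases "B = {}")
  case True
  with assms(2) show ?thesis by (intro bexI[of _ "tok (Top p)"]) (auto intro: le.top)
next
  case False
  with lifts_glb_nonempty[OF assms(1)] show ?thesis by (auto simp: is_glb_def)
qed

end

text \<open>Knaster-Tarski on a carrier set: the meet of the pre-fixed points is a fixed point. The
  relation is a parameter because the lemma is applied to substitutions ordered pointwise. Leastness
  among all pre-fixed points is what allows fixed points of different operators to be
  compared.\<close>

lemma least_fixpoint_on:
  assumes trans: "\<And>x y z. le x y \<Longrightarrow> le y z \<Longrightarrow> le x z"
    and antisym: "\<And>x y. le x y \<Longrightarrow> le y x \<Longrightarrow> x = y"
    and glb: "\<And>B. B \<subseteq> A \<Longrightarrow> \<exists>g \<in> A. (\<forall>b \<in> B. le g b) \<and> (\<forall>h \<in> A. (\<forall>b \<in> B. le h b) \<longrightarrow> le h g)"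
    and F: "\<And>x. x \<in> A \<Longrightarrow> F x \<in> A"
    and mono: "\<And>x y. x \<in> A \<Longrightarrow> y \<in> A \<Longrightarrow> le x y \<Longrightarrow> le (F x) (F y)"
  shows "\<exists>x \<in> A. F x = x \<and> (\<forall>y \<in> A. le (F y) y \<longrightarrow> le x y)"
proof -
  obtain x where x: "x \<in> A" "\<And>y. y \<in> A \<Longrightarrow> le (F y) y \<Longrightarrow> le x y"
    "\<And>h. h \<in> A \<Longrightarrow> \<forall>y \<in> A. le (F y) y \<longrightarrow> le h y \<Longrightarrow> le h x"
    using glb[of "{y \<in> A. le (F y) y}"] by auto
  have below: "le (F x) x"
  proof (rule x(3))
    show "\<forall>y \<in> A. le (F y) y \<longrightarrow> le (F x) y"
      using trans[of "F x"] mono[OF x(1)] x(2) by blast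
  qed (use F x(1) in simp)
  then have "le x (F x)" using x(1,2) F mono by simp
  with below have "F x = x" by (rule antisym)
  with x(1,2) show ?thesis by blast
qed

section \<open>Lifting proofs to marked terms\<close>

lemma proves_mono:
  assumes "proves Sig R H \<alpha>" and "H \<subseteq> H'"
  shows "proves Sig R H' \<alpha>"
  using assms(1)
proof induction
  case (hyp \<alpha>)
  with assms(2) show ?case by (auto intro: proves.hyp)
qed (auto intro: proves.inst proves.recu)

lemma proves_closed:
  assumes "proves Sig R H \<alpha>" and "tss Sig R" and "\<And>\<beta>. \<beta> \<in> H \<Longrightarrow> closed_lit Sig \<beta>"
  shows "closed_lit Sig \<alpha>"
  using assms(1)
proof induction
  case (hyp \<alpha>)
  then show ?case by (rule assms(3))
next
  case (inst Hr c \<sigma>)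
  then have "\<forall>t \<in> lit_terms c. wf_term Sig t" using assms(2) by (auto simp: tss_def)
  with inst.hyps show ?case
    by (cases c) (auto simp: closed_lit_def subst_def intro: closed_subst_aux)
qed (simp add: closed_lit_def)

text \<open>The common setting of both directions: \<open>l\<close> and \<open>r\<close> are the
  components of the related pairs, in either order, and \<open>H\<close> and \<open>H'\<close> the
  negative literals available on the two sides. \<open>known\<close> is what bisimilarity supplies
  for the pairs themselves; \<open>neg\<close> carries negative premises across for every closed
  marked term. \<open>H_subset\<close> serves \<open>Bot p\<close> and \<open>Top p\<close>, which
  stand for the same term on both sides.\<close>

locale lifting = marking Sig K l
  for Sig :: "'f signature" and K :: "'k set" and l :: "'k \<Rightarrow> ('f, 'v) rterm" +
  fixes r :: "'k \<Rightarrow> ('f, 'v) rterm"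
    and R :: "('f, 'v, 'a) rule set" and H H' :: "('f, 'v, 'a) lit set"
  assumes closed_r: "k \<in> K \<Longrightarrow> closed Sig (r k)"
    and format: "ntyft_ntyxt_rec Sig R"
    and H_closed: "\<alpha> \<in> H \<Longrightarrow> closed_lit Sig \<alpha>"
    and H_neg: "\<alpha> \<in> H \<Longrightarrow> \<not> is_pos \<alpha>"
    and H_subset: "H \<subseteq> H'"
    and known: "k \<in> K \<Longrightarrow> proves Sig R H (Trans (l k) a p) \<Longrightarrow>
      \<exists>k' \<in> K. l k' = p \<and> proves Sig R H' (Trans (r k) a (r k'))"
    and neg: "closed (ext_sig Sig (tokens Sig K)) m \<Longrightarrow> NoTrans (proj (token_val l) m) a \<in> H \<Longrightarrow>
      NoTrans (proj (token_val r) m) a \<in> H'"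
begin

abbreviation rproj :: "('f + (('f, 'v) rterm, 'k) token, 'v) rterm \<Rightarrow> ('f, 'v) rterm" where
  "rproj \<equiv> proj (token_val r)"

text \<open>Monotonicity is demanded besides the matching transition so that circular premises can
  be solved by a fixed point. The set \<open>M\<close> allows a first treatment of non-tokens only,
  where the structure of the source is visible.\<close>

definition lifts_along :: "('f, 'v) rterm \<Rightarrow> 'a \<Rightarrow> ('f, 'v) rterm \<Rightarrow>
    ('f + (('f, 'v) rterm, 'k) token, 'v) rterm set \<Rightarrow>
    (('f + (('f, 'v) rterm, 'k) token, 'v) rterm \<Rightarrow> ('f + (('f, 'v) rterm, 'k) token, 'v) rterm) \<Rightarrow> bool"
  where "lifts_along p a q M \<Phi> \<longleftrightarrow>
    (\<forall>m \<in> lifts p \<inter> M. \<Phi> m \<in> lifts q \<and> proves Sig R H' (Trans (rproj m) a (rproj (\<Phi> m)))) \<and>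
    (\<forall>m \<in> lifts p \<inter> M. \<forall>n \<in> lifts p \<inter> M. m \<preceq> n \<longrightarrow> \<Phi> m \<preceq> \<Phi> n)"

abbreviation nontoken :: "('f + (('f, 'v) rterm, 'k) token, 'v) rterm set" where
  "nontoken \<equiv> {m. \<nexists>c. m = tok c}"

lemma closed_token_val_r: "c \<in> tokens Sig K \<Longrightarrow> closed Sig (token_val r c)"
  by (cases c) (auto simp: closed_r)

lemma rproj_subst_aux:
  "wf_marked m \<Longrightarrow> rproj (subst_aux m s) = subst_aux (rproj m) (rproj \<circ> s)"
  using closed_token_val_r by (intro proj_subst_aux) auto

lemma closed_rproj:
  assumes "closed Sig p" and "m \<in> lifts p"
  shows "closed Sig (rproj m)"
  using lifts_closed[OF assms] closed_token_val_r by (rule closed_proj)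

lemma tss: "tss Sig R"
  using format by (simp add: ntyft_ntyxt_rec_def)

lemma proves_trans_closed: "proves Sig R H (Trans p a q) \<Longrightarrow> closed Sig p \<and> closed Sig q"
  using proves_closed[OF _ tss H_closed] by (force simp: closed_lit_def)

text \<open>Tokens do not depend on the last rule of the proof: \<open>Bot p\<close> goes to
  \<open>Bot q\<close>, \<open>Top p\<close> to \<open>Top q\<close>, and \<open>Known k\<close> to
  the token provided by \<open>known\<close>. Monotonicity survives because two distinct comparable
  lifts, at least one of them a token, have \<open>Bot p\<close> as the lower or
  \<open>Top p\<close> as the upper one.\<close>

lemma lifts_along_if_nontoken:
  assumes der: "proves Sig R H (Trans p a q)" and \<Phi>: "lifts_along p a q nontoken \<Phi>"
  shows "\<exists>\<Phi>. lifts_along p a q UNIV \<Phi>"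
proof -
  have pq: "closed Sig p" "closed Sig q" using proves_trans_closed[OF der] by auto
  have der': "proves Sig R H' (Trans p a q)" using der H_subset by (rule proves_mono)
  have "\<forall>k. \<exists>k'. k \<in> K \<longrightarrow> l k = p \<longrightarrow> k' \<in> K \<and> l k' = q \<and> proves Sig R H' (Trans (r k) a (r k'))"
    using known der by metis
  then obtain \<kappa> where \<kappa>: "\<And>k. k \<in> K \<Longrightarrow> l k = p \<Longrightarrow> \<kappa> k \<in> K \<and> l (\<kappa> k) = q \<and>
      proves Sig R H' (Trans (r k) a (r (\<kappa> k)))"
    by metis
  define \<Psi> where "\<Psi> m = (case m of
      Fn (Inr c) _ \<Rightarrow> tok (case c of Bot _ \<Rightarrow> Bot q | Top _ \<Rightarrow> Top q | Known k \<Rightarrow> Known (\<kappa> k))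
    | _ \<Rightarrow> \<Phi> m)" for m
  have \<Psi>_tok: "\<Psi> (tok (Bot p)) = tok (Bot q)" "\<Psi> (tok (Top p)) = tok (Top q)"
    "\<Psi> (tok (Known k)) = tok (Known (\<kappa> k))" for k
    by (simp_all add: \<Psi>_def)
  have \<Psi>_nontok: "\<Psi> m = \<Phi> m" if "m \<in> lifts p" "m \<in> nontoken" for m
    using that by (auto simp: \<Psi>_def lifts_def split: rterm.split sum.split)
  have kinds: "m = tok (Bot p) \<or> m = tok (Top p) \<or> (\<exists>k \<in> K. l k = p \<and> m = tok (Known k)) \<or> m \<in> nontoken"
    if m: "m \<in> lifts p" for m
  proof (cases "m \<in> nontoken")
    case False
    then obtain c where "m = tok c" by auto
    with m show ?thesis by (cases c) auto
  qed simp
  have lift: "\<Psi> m \<in> lifts q \<and> proves Sig R H' (Trans (rproj m) a (rproj (\<Psi> m)))" if "m \<in> lifts p" for m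
    using kinds[OF that] \<kappa> pq der' \<Phi> that \<Psi>_nontok[OF that]
    by (auto simp: \<Psi>_tok lifts_along_def)
  have "\<Psi> m \<preceq> \<Psi> n" if m: "m \<in> lifts p" and n: "n \<in> lifts p" and mn: "m \<preceq> n" for m n
  proof -
    consider "m = tok (Bot p)" | "n = tok (Top p)" | "m = n" | "m \<in> nontoken" "n \<in> nontoken"
    proof (cases "m \<in> nontoken \<and> n \<in> nontoken")
      case False
      then consider c where "m = tok c" | c where "n = tok c" by auto
      then show thesis
      proof cases
        case 1
        have "tok c \<preceq> n" using 1 mn by simp
        then show thesis
          unfolding token_le_iff using 1 m that(1-3) by (auto simp: lifts_def)
      next
        case 2
        have "m \<preceq> tok c" using 2 mn by simp
        then show thesis
          unfolding le_token_iff using 2 n that(1-3) by (auto simp: lifts_def)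
      qed
    qed (use that in blast)
    then show ?thesis
    proof cases
      case 4
      then show ?thesis using m n mn \<Phi> \<Psi>_nontok by (auto simp: lifts_along_def)
    qed (use lift m n pq in \<open>auto simp: \<Psi>_tok le_refl intro!: le.bot le.top\<close>)
  qed
  with lift show ?thesis unfolding lifts_along_def by blast
qed

section \<open>Lifting through the recursion rules\<close>

lemma unfold_in_lifts:
  assumes "Rec X S' \<in> lifts (Rec X S)" and "S' Y = Some m" and "S Y = Some p"
  shows "unfold S' m \<in> lifts (unfold S p)"
proof -
  have "\<nexists>c. Rec X S' = tok c" by simp
  with assms(1) have S': "dom S' = dom S" "\<And>Y m p. S' Y = Some m \<Longrightarrow> S Y = Some p \<Longrightarrow> m \<in> lifts p"
    by (elim lifts_Rec; simp)+
  show ?thesis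
    unfolding unfold_def subst_def
    using S'(2)[OF assms(2,3)]
  proof (rule subst_in_lifts)
    fix x
    show "(if x \<in> dom S' then Rec x S' else Var x) \<in> lifts (if x \<in> dom S then Rec x S else Var x)"
      using S' Rec_in_lifts[where X = x, OF S'] by (auto simp: lifts_def)
  qed
qed

lemma unfold_le:
  assumes "Rec X S \<preceq> Rec X S'" and "m \<preceq> n"
  shows "unfold S m \<preceq> unfold S' n"
proof -
  \<comment> \<open>Comparing recursion terms constrains only their specifications, so
    \<open>X\<close> can be exchanged for any \<open>Z\<close>.\<close>
  have S: "dom S = dom S'" "Rec Z S \<preceq> Rec Z S'" for Z
    using assms(1) by (cases, auto intro: le.rec)+
  show ?thesis
    unfolding unfold_def subst_def using assms(2) by (rule le_subst_aux) (auto simp: S intro: le.var)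
qed

lemma rproj_unfold:
  assumes "wf_marked m"
  shows "rproj (unfold S m) = unfold (map_option rproj \<circ> S) (rproj m)"
  using assms
  by (auto simp: unfold_def subst_def rproj_subst_aux intro!: subst_aux_cong)

text \<open>A marked recursion term is sent to where \<open>\<Phi>\<close> sends its unfolding.
  Unfolding is monotone and commutes with projection, so the recursion rule turns the transition of
  the unfolding on the right into one of the recursion term.\<close>

lemma lifts_along_recursion:
  assumes "closed Sig (Rec X S)" and der: "proves Sig R H (Trans (Rec X S) a q)"
    and \<Phi>: "lifts_along (unfold S (the (S X))) a q UNIV \<Phi>"
  shows "\<exists>\<Phi>. lifts_along (Rec X S) a q UNIV \<Phi>"
proof (rule lifts_along_if_nontoken[OF der])
  define \<Psi> where "\<Psi> m = (case m of Rec _ S' \<Rightarrow> \<Phi> (unfold S' (the (S' X))))" for m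
  have form: "\<exists>S' n. m = Rec X S' \<and> S' X = Some n \<and> wf_marked n \<and> unfold S' n \<in> lifts (unfold S (the (S X)))"
    if m: "m \<in> lifts (Rec X S)" and "m \<in> nontoken" for m
  proof -
    have "\<nexists>c. m = tok c" using that by simp
    with m obtain S' where S': "m = Rec X S'" "dom S' = dom S" "X \<in> dom S"
      by (rule lifts_Rec)
    then obtain n p where "S' X = Some n" "S X = Some p" by blast
    with S' m show ?thesis using unfold_in_lifts[of X S' S X n p] by (auto simp: lifts_def)
  qed
  show "lifts_along (Rec X S) a q nontoken \<Psi>"
    unfolding lifts_along_def
  proof (intro conjI ballI impI)
    fix m
    assume m: "m \<in> lifts (Rec X S) \<inter> nontoken"
    then obtain S' n where S': "m = Rec X S'" "S' X = Some n" "wf_marked n"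
      "unfold S' n \<in> lifts (unfold S (the (S X)))" using form by blast
    have \<Psi>: "\<Psi> m = \<Phi> (unfold S' n)" using S' by (simp add: \<Psi>_def)
    have lift: "\<Phi> (unfold S' n) \<in> lifts q"
      "proves Sig R H' (Trans (rproj (unfold S' n)) a (rproj (\<Phi> (unfold S' n))))"
      using \<Phi> S'(4) by (auto simp: lifts_along_def)
    show "\<Psi> m \<in> lifts q" using lift \<Psi> by simp
    have "closed Sig (rproj m)" using assms(1) m by (auto intro: closed_rproj)
    moreover have "closed Sig (rproj (\<Psi> m))"
      using proves_trans_closed[OF der] lift(1) \<Psi> by (auto intro: closed_rproj)
    ultimately have "proves Sig R H' (Trans (Rec X (map_option rproj \<circ> S')) a (rproj (\<Phi> (unfold S' n))))"
      using lift(2) S'(1-3) unfolding \<Psi> by (intro proves.recu) (auto simp: rproj_unfold)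
    then show "proves Sig R H' (Trans (rproj m) a (rproj (\<Psi> m)))"
      unfolding \<Psi> using S'(1) by simp
  next
    fix m n
    assume mn: "m \<in> lifts (Rec X S) \<inter> nontoken" "n \<in> lifts (Rec X S) \<inter> nontoken" "m \<preceq> n"
    obtain S1 m1 where m: "m = Rec X S1" "S1 X = Some m1"
      "unfold S1 m1 \<in> lifts (unfold S (the (S X)))" using form mn(1) by blast
    obtain S2 n2 where n: "n = Rec X S2" "S2 X = Some n2"
      "unfold S2 n2 \<in> lifts (unfold S (the (S X)))" using form mn(2) by blast
    have le: "Rec X S1 \<preceq> Rec X S2" using mn m n by simp
    then have "m1 \<preceq> n2" by cases (use m n in auto)
    with le have "unfold S1 m1 \<preceq> unfold S2 n2" by (rule unfold_le)
    then show "\<Psi> m \<preceq> \<Psi> n" using m n \<Phi> by (auto simp: \<Psi>_def lifts_along_def)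
  qed
qed

section \<open>Lifting through the rules in ntyft/ntyxt format\<close>

definition subst_lifts :: "('v \<Rightarrow> ('f, 'v) rterm) \<Rightarrow> ('v \<Rightarrow> ('f + (('f, 'v) rterm, 'k) token, 'v) rterm) set"
  where "subst_lifts \<sigma> = {s. \<forall>x. s x \<in> lifts (\<sigma> x)}"

lemma subst_lifts_glb:
  assumes "closed_subst Sig \<sigma>" and "B \<subseteq> subst_lifts \<sigma>"
  shows "\<exists>g \<in> subst_lifts \<sigma>. (\<forall>s \<in> B. \<forall>x. g x \<preceq> s x) \<and>
    (\<forall>h \<in> subst_lifts \<sigma>. (\<forall>s \<in> B. \<forall>x. h x \<preceq> s x) \<longrightarrow> (\<forall>x. h x \<preceq> g x))"
proof -
  have "\<exists>g \<in> lifts (\<sigma> x). (\<forall>m \<in> (\<lambda>s. s x) ` B. g \<preceq> m) \<and>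
      (\<forall>h \<in> lifts (\<sigma> x). (\<forall>m \<in> (\<lambda>s. s x) ` B. h \<preceq> m) \<longrightarrow> h \<preceq> g)" for x
    using assms by (intro lifts_glb) (auto simp: subst_lifts_def closed_subst_def)
  then have "\<forall>x. \<exists>g. g \<in> lifts (\<sigma> x) \<and> (\<forall>s \<in> B. g \<preceq> s x) \<and>
      (\<forall>h \<in> lifts (\<sigma> x). (\<forall>s \<in> B. h \<preceq> s x) \<longrightarrow> h \<preceq> g)"
    by (simp add: Bex_def)
  from choice[OF this] obtain g where g: "\<forall>x. g x \<in> lifts (\<sigma> x) \<and> (\<forall>s \<in> B. g x \<preceq> s x) \<and>
      (\<forall>h \<in> lifts (\<sigma> x). (\<forall>s \<in> B. h \<preceq> s x) \<longrightarrow> h \<preceq> g x)" ..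
  show ?thesis
    by (rule bexI[of _ g]) (use g in \<open>auto simp: subst_lifts_def\<close>)
qed

text \<open>A source has at most one function symbol and no repeated variable, so marked values of
  its variables can be read off a non-token lift of its instance. Other variables get the default
  \<open>emb (\<sigma> z)\<close>, which is independent of the lift and hence monotone.\<close>

lemma source_matching:
  assumes "closed_subst Sig \<sigma>" and s: "s = Var x \<or> s = Fn f (map Var xs) \<and> distinct xs"
  obtains b where
    "\<And>m. m \<in> lifts (subst_aux s \<sigma>) \<inter> nontoken \<Longrightarrow> b m \<in> subst_lifts \<sigma> \<and> subst_aux (emb s) (b m) = m"
    "\<And>m n z. m \<in> lifts (subst_aux s \<sigma>) \<inter> nontoken \<Longrightarrow> n \<in> lifts (subst_aux s \<sigma>) \<inter> nontoken \<Longrightarrow>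
      m \<preceq> n \<Longrightarrow> b m z \<preceq> b n z"
  using s
proof
  assume s: "s = Var x"
  have emb: "emb (\<sigma> z) \<in> lifts (\<sigma> z)" for z
    using assms(1) by (auto simp: closed_subst_def closed_def intro: emb_in_lifts)
  show thesis
    by (rule that[of "\<lambda>m z. if z = x then m else emb (\<sigma> z)"])
      (auto simp: s subst_lifts_def emb le_refl)
next
  assume s: "s = Fn f (map Var xs) \<and> distinct xs"
  have emb: "emb (\<sigma> z) \<in> lifts (\<sigma> z)" for z
    using assms(1) by (auto simp: closed_subst_def closed_def intro: emb_in_lifts)
  define b where "b m z = (case m of Fn h ms \<Rightarrow>
    (case map_of (zip xs ms) z of Some n \<Rightarrow> n | None \<Rightarrow> emb (\<sigma> z)))"
    for m :: "('f + (('f, 'v) rterm, 'k) token, 'v) rterm" and z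
  have form: "\<exists>ms. m = Fn (Inl f) ms \<and> length ms = length xs \<and>
      (\<forall>i < length xs. ms ! i \<in> lifts (\<sigma> (xs ! i)))"
    if "m \<in> lifts (subst_aux s \<sigma>) \<inter> nontoken" for m
  proof -
    have "m \<in> lifts (Fn f (map \<sigma> xs))" "\<nexists>c. m = tok c"
      using that s by (auto simp: comp_def)
    then show ?thesis by (rule lifts_Fn) auto
  qed
  \<comment> \<open>Distinctness of \<open>xs\<close> ensures that the lookup of
    \<open>xs ! i\<close> stops at position \<open>i\<close>.\<close>
  have b_nth: "b (Fn h ms) (xs ! i) = ms ! i" if "length ms = length xs" "i < length xs" for h ms i
    using that s by (simp add: b_def map_of_zip_nth)
  have b_other: "b (Fn h ms) z = emb (\<sigma> z)" if "length ms = length xs" "z \<notin> set xs" for h ms z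
  proof -
    have "map_of (zip xs ms) z = None" using that by simp
    then show ?thesis by (simp add: b_def)
  qed
  show thesis
  proof (rule that[of b])
    fix m
    assume "m \<in> lifts (subst_aux s \<sigma>) \<inter> nontoken"
    then obtain ms where ms: "m = Fn (Inl f) ms" "length ms = length xs"
      "\<And>i. i < length xs \<Longrightarrow> ms ! i \<in> lifts (\<sigma> (xs ! i))" using form by blast
    have "b m z \<in> lifts (\<sigma> z)" for z
      using ms emb b_nth b_other by (cases "z \<in> set xs") (auto simp: in_set_conv_nth)
    moreover have "map (b m) xs = ms"
      using ms b_nth by (auto intro: nth_equalityI)
    ultimately show "b m \<in> subst_lifts \<sigma> \<and> subst_aux (emb s) (b m) = m"
      using s ms by (auto simp: subst_lifts_def comp_def)
  next
    fix m n z
    assume mn: "m \<in> lifts (subst_aux s \<sigma>) \<inter> nontoken" "n \<in> lifts (subst_aux s \<sigma>) \<inter> nontoken" "m \<preceq> n"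
    obtain ms ns where ms: "m = Fn (Inl f) ms" "length ms = length xs"
      and ns: "n = Fn (Inl f) ns" "length ns = length xs" using form[OF mn(1)] form[OF mn(2)] by blast
    have "Fn (Inl f) ms \<preceq> Fn (Inl f) ns" using mn(3) ms ns by simp
    then have "ms ! i \<preceq> ns ! i" if "i < length xs" for i
      by cases (use that ms in auto)
    then show "b m z \<preceq> b n z"
      using ms ns b_nth b_other by (cases "z \<in> set xs") (auto simp: in_set_conv_nth le_refl)
  qed
qed

lemma rule_premise_cases:
  assumes "(Hr, c) \<in> R" and "\<beta> \<in> Hr"
  obtains t b y where "\<beta> = Trans t b (Var y)" "y \<notin> fv (source c)" "wf_term Sig t"
  | t b where "\<beta> = NoTrans t b" "wf_term Sig t"
proof -
  have nt: "ntytt (Hr, c)" and wf: "\<forall>t \<in> lit_terms \<beta>. wf_term Sig t"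
    using format assms by (auto simp: ntyft_ntyxt_rec_def ntyft_def ntyxt_def tss_def)
  show thesis
  proof (cases "is_pos \<beta>")
    case True
    then obtain t b y where "\<beta> = Trans t b (Var y)" "y \<notin> fv (source c)"
      using nt assms(2) by (auto simp: ntytt_def)
    with wf show thesis by (intro that(1)) auto
  next
    case False
    with wf show thesis by (cases \<beta>) (auto intro: that(2))
  qed
qed

lemma rule_conclusion_pos: "(Hr, c) \<in> R \<Longrightarrow> is_pos c"
  using format by (auto simp: ntyft_ntyxt_rec_def ntyft_def ntyxt_def ntytt_def)

text \<open>Rules of the format and recursion rules have positive conclusions, so a negative literal
  can only be a leaf.\<close>

lemma proves_NoTrans:
  assumes "proves Sig R H (NoTrans p a)"
  shows "NoTrans p a \<in> H"
  using assms
proof cases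
  case (inst Hr c \<sigma>)
  then show ?thesis using rule_conclusion_pos[of Hr c] by (cases c) auto
qed

text \<open>The premises of a rule may be circular, so the lifts of their right-hand sides are
  obtained all at once as a least fixed point; leastness makes them monotone in the lift of
  the source.\<close>

lemma lifts_along_rule:
  assumes rule: "(Hr, Trans s a u) \<in> R" and \<sigma>: "closed_subst Sig \<sigma>"
    and prem: "\<And>\<beta>. \<beta> \<in> Hr \<Longrightarrow> proves Sig R H (subst_lit \<sigma> \<beta>)"
    and IH: "\<And>t b y. Trans t b (Var y) \<in> Hr \<Longrightarrow> \<exists>\<Phi>. lifts_along (subst_aux t \<sigma>) b (\<sigma> y) UNIV \<Phi>"
  shows "\<exists>\<Phi>. lifts_along (subst_aux s \<sigma>) a (subst_aux u \<sigma>) UNIV \<Phi>"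
proof -
  have fmt: "ntyft Sig (Hr, Trans s a u) \<or> ntyxt (Hr, Trans s a u)"
    and wf_s: "wf_term Sig s" and wf_u: "wf_term Sig u"
    using format rule by (auto simp: ntyft_ntyxt_rec_def tss_def)
  then obtain x f xs where "s = Var x \<or> s = Fn f (map Var xs) \<and> distinct xs"
    by (auto simp: ntyft_def ntyxt_def)
  with \<sigma> obtain base where base:
    "\<And>m. m \<in> lifts (subst_aux s \<sigma>) \<inter> nontoken \<Longrightarrow> base m \<in> subst_lifts \<sigma> \<and> subst_aux (emb s) (base m) = m"
    "\<And>m n z. m \<in> lifts (subst_aux s \<sigma>) \<inter> nontoken \<Longrightarrow> n \<in> lifts (subst_aux s \<sigma>) \<inter> nontoken \<Longrightarrow>
      m \<preceq> n \<Longrightarrow> base m z \<preceq> base n z"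
    by (rule source_matching) blast
  \<comment> \<open>A variable is the right-hand side of at most one premise, so its marked value is
    governed by a single map.\<close>
  have uniq: "t = t' \<and> b = b'" if "Trans t b (Var y) \<in> Hr" "Trans t' b' (Var y) \<in> Hr" for t t' b b' y
    using fmt that unfolding ntyft_def ntyxt_def ntytt_def by fast
  define Y where "Y = {y. \<exists>t b. Trans t b (Var y) \<in> Hr}"
  have "\<forall>y. \<exists>t b \<Phi>. y \<in> Y \<longrightarrow> Trans t b (Var y) \<in> Hr \<and> lifts_along (subst_aux t \<sigma>) b (\<sigma> y) UNIV \<Phi>"
    using IH unfolding Y_def by blast
  then obtain T L \<Psi> where T: "\<And>y. y \<in> Y \<Longrightarrow> Trans (T y) (L y) (Var y) \<in> Hr"
    and \<Psi>: "\<And>y. y \<in> Y \<Longrightarrow> lifts_along (subst_aux (T y) \<sigma>) (L y) (\<sigma> y) UNIV (\<Psi> y)"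
    by metis
  have wf_T: "wf_term Sig (T y)" and Y_fv: "y \<notin> fv s" if "y \<in> Y" for y
    using rule_premise_cases[OF rule T[OF that]] by auto
  have subst_T: "subst_aux (emb (T y)) s' \<in> lifts (subst_aux (T y) \<sigma>)" if "y \<in> Y" "s' \<in> subst_lifts \<sigma>" for y s'
    using that wf_T by (auto simp: subst_lifts_def intro!: subst_in_lifts emb_in_lifts)
  \<comment> \<open>A fixed point of \<open>F b\<close> is a marked substitution that agrees with
    \<open>b\<close> off \<open>Y\<close> and assigns to each \<open>y \<in> Y\<close> the image of
    the premise source under that same substitution. It thus satisfies all positive premises
    simultaneously, even circular ones.\<close>
  define F where "F b s' z = (if z \<in> Y then \<Psi> z (subst_aux (emb (T z)) s') else b z)" for b s' z
  have F_mono: "\<forall>z. F b s1 z \<preceq> F b' s2 z"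
    if "s1 \<in> subst_lifts \<sigma>" "s2 \<in> subst_lifts \<sigma>" "\<forall>z. s1 z \<preceq> s2 z" "\<forall>z. b z \<preceq> b' z" for b b' s1 s2
  proof
    fix z
    have "subst_aux (emb (T z)) s1 \<preceq> subst_aux (emb (T z)) s2"
      using that le_refl by (intro le_subst_aux) auto
    then show "F b s1 z \<preceq> F b' s2 z"
      using that \<Psi>[of z] subst_T[of z] unfolding F_def lifts_along_def by auto
  qed
  have "\<exists>s' \<in> subst_lifts \<sigma>. F b s' = s' \<and> (\<forall>s'' \<in> subst_lifts \<sigma>. (\<forall>z. F b s'' z \<preceq> s'' z) \<longrightarrow> (\<forall>z. s' z \<preceq> s'' z))"
    if b: "b \<in> subst_lifts \<sigma>" for b
  proof (rule least_fixpoint_on[where le = "\<lambda>s s'. \<forall>z. s z \<preceq> s' z"])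
    show "F b s' \<in> subst_lifts \<sigma>" if "s' \<in> subst_lifts \<sigma>" for s'
      using b that \<Psi> subst_T unfolding F_def lifts_along_def by (auto simp: subst_lifts_def)
    show "\<forall>z. F b s1 z \<preceq> F b s2 z"
      if "s1 \<in> subst_lifts \<sigma>" "s2 \<in> subst_lifts \<sigma>" "\<forall>z. s1 z \<preceq> s2 z" for s1 s2
      using F_mono that le_refl by simp
    show "\<forall>z. s1 z \<preceq> s3 z" if "\<forall>z. s1 z \<preceq> s2 z" "\<forall>z. s2 z \<preceq> s3 z" for s1 s2 s3
      using that le_trans by blast
    show "s1 = s2" if "\<forall>z. s1 z \<preceq> s2 z" "\<forall>z. s2 z \<preceq> s1 z" for s1 s2
      using that le_antisym by blast
  qed (rule subst_lifts_glb[OF \<sigma>])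
  then obtain fp where fp: "\<And>b. b \<in> subst_lifts \<sigma> \<Longrightarrow> fp b \<in> subst_lifts \<sigma>"
    "\<And>b. b \<in> subst_lifts \<sigma> \<Longrightarrow> F b (fp b) = fp b"
    "\<And>b s'. b \<in> subst_lifts \<sigma> \<Longrightarrow> s' \<in> subst_lifts \<sigma> \<Longrightarrow> \<forall>z. F b s' z \<preceq> s' z \<Longrightarrow> \<forall>z. fp b z \<preceq> s' z"
    by metis
  define \<Phi> where "\<Phi> m = subst_aux (emb u) (fp (base m))" for m
  have der: "proves Sig R H (Trans (subst_aux s \<sigma>) a (subst_aux u \<sigma>))"
    using proves.inst[OF rule \<sigma>] prem by (simp add: subst_def)
  show ?thesis
  proof (rule lifts_along_if_nontoken[OF der])
    show "lifts_along (subst_aux s \<sigma>) a (subst_aux u \<sigma>) nontoken \<Phi>"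
      unfolding lifts_along_def
    proof (intro conjI ballI impI)
      fix m
      assume m: "m \<in> lifts (subst_aux s \<sigma>) \<inter> nontoken"
      define s' where "s' = fp (base m)"
      have s': "s' \<in> subst_lifts \<sigma>" "F (base m) s' = s'" using base(1)[OF m] fp by (auto simp: s'_def)
      show "\<Phi> m \<in> lifts (subst_aux u \<sigma>)"
        using s'(1) wf_u unfolding \<Phi>_def s'_def[symmetric]
        by (auto simp: subst_lifts_def intro!: subst_in_lifts emb_in_lifts)
      \<comment> \<open>By the format, source variables are not right-hand sides of premises, so the
        fixed point keeps their values and the source still instantiates to
        \<open>m\<close>.\<close>
      have "s' z = base m z" if "z \<in> fv s" for z
        using that Y_fv s'(2) by (metis F_def)
      then have "subst_aux (emb s) s' = subst_aux (emb s) (base m)"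
        by (intro subst_aux_cong) simp
      then have src: "subst_aux (emb s) s' = m" using base(1)[OF m] by simp
      have rproj_emb: "rproj (subst_aux (emb t) s') = subst_aux t (rproj \<circ> s')" if "wf_term Sig t" for t
        using that by (rule proj_subst_emb)
      have closed: "closed_subst Sig (rproj \<circ> s')"
        using \<sigma> s'(1) closed_rproj by (auto simp: closed_subst_def subst_lifts_def)
      have "proves Sig R H' (subst_lit (rproj \<circ> s') \<beta>)" if \<beta>: "\<beta> \<in> Hr" for \<beta>
        using rule \<beta>
      proof (cases rule: rule_premise_cases)
        case (1 t b y)
        then have y: "y \<in> Y" using \<beta> by (auto simp: Y_def)
        with 1 uniq T \<beta> have t: "T y = t" "L y = b" by blast+
        have "s' y = \<Psi> y (subst_aux (emb t) s')" using s'(2) y t by (metis F_def)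
        moreover have "proves Sig R H' (Trans (rproj (subst_aux (emb t) s')) b
            (rproj (\<Psi> y (subst_aux (emb t) s'))))"
          using \<Psi>[OF y] subst_T[OF y s'(1)] t by (auto simp: lifts_along_def)
        ultimately show ?thesis using 1 rproj_emb by (simp add: subst_def)
      next
        case (2 t b)
        have "NoTrans (subst_aux t \<sigma>) b \<in> H"
          using prem[OF \<beta>] 2 proves_NoTrans by (simp add: subst_def)
        moreover have lift: "subst_aux (emb t) s' \<in> lifts (subst_aux t \<sigma>)"
          using s'(1) 2 by (auto simp: subst_lifts_def intro!: subst_in_lifts emb_in_lifts)
        moreover have "closed Sig (subst_aux t \<sigma>)" using closed_subst_aux[OF 2(2) \<sigma>] .
        ultimately have "NoTrans (rproj (subst_aux (emb t) s')) b \<in> H'"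
          using lifts_closed by (intro neg) (auto simp: lifts_def)
        then show ?thesis using 2 rproj_emb by (auto simp: subst_def intro: proves.hyp)
      qed
      then have "proves Sig R H' (subst_lit (rproj \<circ> s') (Trans s a u))"
        using proves.inst[OF rule closed] by blast
      then show "proves Sig R H' (Trans (rproj m) a (rproj (\<Phi> m)))"
        using rproj_emb[OF wf_s] rproj_emb[OF wf_u] src
        by (simp add: subst_def \<Phi>_def s'_def)
    next
      fix m n
      assume mn: "m \<in> lifts (subst_aux s \<sigma>) \<inter> nontoken" "n \<in> lifts (subst_aux s \<sigma>) \<inter> nontoken" "m \<preceq> n"
      have b: "base m \<in> subst_lifts \<sigma>" "base n \<in> subst_lifts \<sigma>" using base(1) mn by auto
      \<comment> \<open>Since \<open>fp (base n)\<close> is fixed by \<open>F (base n)\<close>, it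
        is a pre-fixed point of the smaller operator \<open>F (base m)\<close> and so lies above its
        least one.\<close>
      have "\<forall>z. F (base m) (fp (base n)) z \<preceq> F (base n) (fp (base n)) z"
        using fp(1) b base(2)[OF mn] le_refl by (intro F_mono) auto
      then have "\<forall>z. fp (base m) z \<preceq> fp (base n) z"
        using fp b by metis
      then show "\<Phi> m \<preceq> \<Phi> n"
        unfolding \<Phi>_def using le_refl by (intro le_subst_aux) auto
    qed
  qed
qed

text \<open>Leaves are negative and yield no transition; every inner node is covered by the lifting
  for its rule.\<close>

lemma proves_lifts_along:
  assumes "proves Sig R H \<alpha>" and "\<alpha> = Trans p a q"
  shows "\<exists>\<Phi>. lifts_along p a q UNIV \<Phi>"
  using assms
proof (induction arbitrary: p a q)
  case (hyp \<alpha>)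
  then show ?case using H_neg by fastforce
next
  case (inst Hr c \<sigma>)
  then obtain s u where c: "c = Trans s a u" "p = subst_aux s \<sigma>" "q = subst_aux u \<sigma>"
    by (cases c) (auto simp: subst_def)
  show ?case
    unfolding c(2,3)
  proof (rule lifts_along_rule)
    fix t b y
    assume "Trans t b (Var y) \<in> Hr"
    then show "\<exists>\<Phi>. lifts_along (subst_aux t \<sigma>) b (\<sigma> y) UNIV \<Phi>"
      using inst.IH by (force simp: subst_def)
  qed (use inst c in auto)
next
  case (recu X S q' a')
  then have eq: "p = Rec X S" "q = q'" "a = a'" by auto
  have "proves Sig R H (Trans (Rec X S) a' q')"
    using recu.hyps by (rule proves.recu)
  moreover obtain \<Phi> where "lifts_along (unfold S (the (S X))) a' q' UNIV \<Phi>"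
    using recu.IH by blast
  ultimately show ?case
    unfolding eq using recu.hyps(1) lifts_along_recursion by blast
qed

text \<open>The map for the given proof is applied to \<open>m\<close>. Monotonicity has served the
  circular premises and is dropped.\<close>

theorem lift_transition:
  assumes "closed (ext_sig Sig (tokens Sig K)) m" and "proves Sig R H (Trans (lproj m) a p)"
  shows "\<exists>n. closed (ext_sig Sig (tokens Sig K)) n \<and> lproj n = p \<and>
    proves Sig R H' (Trans (rproj m) a (rproj n))"
proof -
  obtain \<Phi> where \<Phi>: "lifts_along (lproj m) a p UNIV \<Phi>"
    using proves_lifts_along assms(2) by blast
  have "m \<in> lifts (lproj m)" using assms(1) by (simp add: lifts_def closed_def)
  with \<Phi> have n: "\<Phi> m \<in> lifts p" "proves Sig R H' (Trans (rproj m) a (rproj (\<Phi> m)))"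
    by (auto simp: lifts_along_def)
  moreover have "closed Sig p" using proves_trans_closed[OF assms(2)] by simp
  ultimately show ?thesis using lifts_closed by (auto simp: lifts_def)
qed

end

section \<open>The well-founded semantics as a fixed point\<close>

lemma PTneg_antimono: "C \<subseteq> C' \<Longrightarrow> PTneg Sig C' \<subseteq> PTneg Sig C"
  by (auto simp: PTneg_def)

lemma PTpos_antimono: "C \<subseteq> C' \<Longrightarrow> PTpos Sig R C' \<subseteq> PTpos Sig R C"
  by (auto simp: PTpos_def intro: proves_mono[OF _ PTneg_antimono])

lemma CTneg_mono: "C \<subseteq> C' \<Longrightarrow> CTneg Sig R C \<subseteq> CTneg Sig R C'"
  using PTpos_antimono[of C C' Sig R] by (auto simp: CTneg_def)

lemma CTpos_mono: "C \<subseteq> C' \<Longrightarrow> CTpos Sig R C \<subseteq> CTpos Sig R C'"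
  by (auto simp: CTpos_def intro: proves_mono[OF _ CTneg_mono])

section \<open>Ordinal stages and their stabilisation\<close>

lemma Card_order_wfs_ord: "Card_order wfs_ord"
  unfolding wfs_ord_def by (intro cardSuc_Card_order card_of_Card_order)

lemma Well_order_wfs_ord: "Well_order wfs_ord"
  using Card_order_wfs_ord card_order_on_well_order_on by blast

lemma wf_wfs_ord: "wf (wfs_ord - Id)"
  using Well_order_wfs_ord unfolding well_order_on_def by blast

lemma CT_stage_eq: "CT_stage Sig R i = CTpos Sig R (\<Union>j \<in> underS wfs_ord i. CT_stage Sig R j)"
proof -
  have "CT_stage Sig R i = CTpos Sig R (\<Union>j \<in> underS wfs_ord i. cut (CT_stage Sig R) (wfs_ord - Id) i j)"
    unfolding CT_stage_def by (subst wfrec[OF wf_wfs_ord]) simp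
  \<comment> \<open>The indices in \<open>underS wfs_ord i\<close> strictly precede
    \<open>i\<close>, so the cutoff of well-founded recursion changes nothing there.\<close>
  also have "(\<Union>j \<in> underS wfs_ord i. cut (CT_stage Sig R) (wfs_ord - Id) i j) =
      (\<Union>j \<in> underS wfs_ord i. CT_stage Sig R j)"
    by (intro SUP_cong) (auto simp: cut_def underS_def)
  finally show ?thesis .
qed

lemma underS_wfs_ord_mono:
  assumes "(i, j) \<in> wfs_ord"
  shows "underS wfs_ord i \<subseteq> underS wfs_ord j"
  using assms Well_order_wfs_ord
  by (intro underS_incr) (auto simp: order_on_defs)

lemma CT_stage_mono: "(i, j) \<in> wfs_ord \<Longrightarrow> CT_stage Sig R i \<subseteq> CT_stage Sig R j"
  unfolding CT_stage_eq[of _ _ i] CT_stage_eq[of _ _ j]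
  using underS_wfs_ord_mono by (intro CTpos_mono) blast

lemma CT_stage_subset_CTplus: "(\<Union>j \<in> underS wfs_ord i. CT_stage Sig R j) \<subseteq> CTplus Sig R"
  unfolding CTplus_def underS_def by (blast intro: FieldI1)

text \<open>Needed for the regularity of the successor cardinal. Terms embed into literals, and
  wrapping a term in a unary application is injective but misses nullary ones, impossible on a
  finite type.\<close>

lemma infinite_lits: "infinite (UNIV :: ('f, 'v, 'a) lit set)"
proof
  assume "finite (UNIV :: ('f, 'v, 'a) lit set)"
  moreover have "inj (\<lambda>t :: ('f, 'v) rterm. NoTrans t (undefined :: 'a))" by (simp add: inj_def)
  ultimately have "finite (UNIV :: ('f, 'v) rterm set)" by (metis finite_imageD finite_subset subset_UNIV)
  moreover have "inj (\<lambda>t :: ('f, 'v) rterm. Fn undefined [t])" by (simp add: inj_def)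
  ultimately have "surj (\<lambda>t :: ('f, 'v) rterm. Fn undefined [t])" by (rule finite_UNIV_inj_surj)
  from surjD[OF this, of "Fn undefined []"] show False by simp
qed

text \<open>The stages increase along a regular cardinal, and their union has at most as many
  elements as there are literals, which is fewer than the length of the chain. Hence a single stage
  contains the union.\<close>

lemma CTplus_stabilises:
  fixes R :: "('f, 'v, 'a) rule set"
  obtains i where "i \<in> Field wfs_ord" and "(\<Union>j \<in> underS wfs_ord i. CT_stage Sig R j) = CTplus Sig R"
proof -
  have "relChain wfs_ord (CT_stage Sig R)"
    unfolding relChain_def using CT_stage_mono by blast
  then have "\<exists>i \<in> Field wfs_ord. CTplus Sig R \<subseteq> CT_stage Sig R i"
    unfolding wfs_ord_def
  proof (rule cardSuc_UNION[OF card_of_Card_order, rotated])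
    show "CTplus Sig R \<subseteq> (\<Union>i \<in> Field (cardSuc (card_of UNIV)). CT_stage Sig R i)"
      by (simp add: CTplus_def wfs_ord_def)
  qed (simp_all add: infinite_lits Field_card_of card_of_mono1)
  then obtain i where i: "i \<in> Field wfs_ord" "CTplus Sig R \<subseteq> CT_stage Sig R i" by blast
  have "infinite (Field (wfs_ord :: ('f, 'v, 'a) lit set rel))"
    unfolding wfs_ord_def using infinite_lits
    by (simp add: cardSuc_finite[OF card_of_Card_order] Field_card_of)
  \<comment> \<open>The union at an index ranges over strictly earlier stages only, so an index
    above \<open>i\<close> is needed; an infinite cardinal has no last element.\<close>
  then obtain j where j: "j \<in> Field wfs_ord" "i \<noteq> j" "(i, j) \<in> wfs_ord"
    using infinite_Card_order_limit[OF Card_order_wfs_ord _ i(1)] by blast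
  have "(\<Union>k \<in> underS wfs_ord j. CT_stage Sig R k) = CTplus Sig R"
  proof
    have "i \<in> underS wfs_ord j" using j by (simp add: underS_def)
    with i(2) show "CTplus Sig R \<subseteq> (\<Union>k \<in> underS wfs_ord j. CT_stage Sig R k)" by blast
  qed (rule CT_stage_subset_CTplus)
  with j(1) show thesis by (rule that)
qed

text \<open>At an index where the union has stabilised, the stage is \<open>CTpos\<close> of
  \<open>CTplus\<close> and also a part of \<open>CTplus\<close>. The converse inclusion is
  monotonicity.\<close>

lemma CTplus_fixed: "CTpos Sig R (CTplus Sig R) = CTplus Sig R"
proof
  obtain i where i: "i \<in> Field wfs_ord" "(\<Union>j \<in> underS wfs_ord i. CT_stage Sig R j) = CTplus Sig R"
    by (rule CTplus_stabilises)
  then show "CTpos Sig R (CTplus Sig R) \<subseteq> CTplus Sig R"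
    using CT_stage_eq[of Sig R i] by (auto simp: CTplus_def)
  have "CT_stage Sig R j \<subseteq> CTpos Sig R (CTplus Sig R)" for j
    unfolding CT_stage_eq[of _ _ j] by (intro CTpos_mono CT_stage_subset_CTplus)
  then show "CTplus Sig R \<subseteq> CTpos Sig R (CTplus Sig R)" by (auto simp: CTplus_def)
qed

text \<open>One inclusion is read off at the stabilising index. The other holds because each stage
  applies the antitone \<open>PTpos\<close> to a subset of \<open>CTplus\<close>.\<close>

lemma PTplus_eq: "PTplus Sig R = PTpos Sig R (CTplus Sig R)"
proof
  obtain i where i: "i \<in> Field wfs_ord" "(\<Union>j \<in> underS wfs_ord i. CT_stage Sig R j) = CTplus Sig R"
    by (rule CTplus_stabilises)
  then have "PT_stage Sig R i = PTpos Sig R (CTplus Sig R)" by (simp add: PT_stage_def)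
  with i(1) show "PTplus Sig R \<subseteq> PTpos Sig R (CTplus Sig R)" by (auto simp: PTplus_def)
  show "PTpos Sig R (CTplus Sig R) \<subseteq> PTplus Sig R"
    unfolding PTplus_def PT_stage_def
    by (intro INT_greatest PTpos_antimono CT_stage_subset_CTplus)
qed

text \<open>Each stage is \<open>CTpos\<close> of a union of earlier stages, so transfinite
  induction needs no separate cases; the start is the empty union.\<close>

lemma CTplus_induct:
  assumes step: "\<And>C. P C \<Longrightarrow> P (CTpos Sig R C)" and Union: "\<And>\<C>. \<forall>C \<in> \<C>. P C \<Longrightarrow> P (\<Union>\<C>)"
  shows "P (CTplus Sig R)"
proof -
  have "P (CT_stage Sig R i)" for i
  proof (induction i rule: wf_induct_rule[OF wf_wfs_ord])
    case (1 i)
    then have "P (\<Union>j \<in> underS wfs_ord i. CT_stage Sig R j)"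
      by (intro Union) (auto simp: underS_def)
    then show ?case unfolding CT_stage_eq[of _ _ i] by (rule step)
  qed
  then show ?thesis unfolding CTplus_def by (intro Union) auto
qed

section \<open>The congruence theorem\<close>

lemma bisim_pre_closed: "bisim_pre Sig R p q \<Longrightarrow> closed Sig p \<and> closed Sig q"
  by (auto simp: bisim_pre_def bisimulation_def)

lemma bisimulation_step:
  assumes "bisimulation Sig R Rel" and "(p, q) \<in> Rel"
  shows "ct_trans Sig R p a p' \<Longrightarrow> \<exists>q'. ct_trans Sig R q a q' \<and> (p', q') \<in> Rel"
    and "pt_trans Sig R q a q' \<Longrightarrow> \<exists>p'. pt_trans Sig R p a p' \<and> (p', q') \<in> Rel"
  using bspec[OF conjunct2[OF assms(1)[unfolded bisimulation_def]] assms(2)] by simp_all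

lemma bisim_pre_ct:
  assumes "bisim_pre Sig R p q" and "ct_trans Sig R p a p'"
  shows "\<exists>q'. ct_trans Sig R q a q' \<and> bisim_pre Sig R p' q'"
  using assms bisimulation_step(1) unfolding bisim_pre_def by meson

lemma bisim_pre_pt:
  assumes "bisim_pre Sig R p q" and "pt_trans Sig R q a q'"
  shows "\<exists>p'. pt_trans Sig R p a p' \<and> bisim_pre Sig R p' q'"
  using assms bisimulation_step(2) unfolding bisim_pre_def by meson

section \<open>Marked terms over related pairs and their simulation along the stages\<close>

definition bisim_pairs :: "'f signature \<Rightarrow> ('f, 'v, 'a) rule set \<Rightarrow> (('f, 'v) rterm \<times> ('f, 'v) rterm) set" where
  "bisim_pairs Sig R = {(p, q). bisim_pre Sig R p q}"

definition marked :: "'f signature \<Rightarrow> ('f, 'v, 'a) rule set \<Rightarrow>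
    ('f + (('f, 'v) rterm, ('f, 'v) rterm \<times> ('f, 'v) rterm) token, 'v) rterm set" where
  "marked Sig R = {m. closed (ext_sig Sig (tokens Sig (bisim_pairs Sig R))) m}"

abbreviation "left \<equiv> proj (token_val fst)"
abbreviation "right \<equiv> proj (token_val snd)"

lemma marking_bisim_pairs: "marking Sig (bisim_pairs Sig R) fst" "marking Sig (bisim_pairs Sig R) snd"
  by (unfold_locales) (auto simp: bisim_pairs_def dest: bisim_pre_closed)

lemma closed_left: "m \<in> marked Sig R \<Longrightarrow> closed Sig (left m)"
  unfolding marked_def by (auto intro!: closed_proj dest: marking.closed_token_val[OF marking_bisim_pairs(1)])

lemma closed_right: "m \<in> marked Sig R \<Longrightarrow> closed Sig (right m)"
  unfolding marked_def by (auto intro!: closed_proj dest: marking.closed_token_val[OF marking_bisim_pairs(2)])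

text \<open>The invariant of the induction along the stages. The answer is required in
  \<open>CTplus\<close> rather than in \<open>C\<close>, since bisimilarity answers a transition of
  one stage by a certain transition that may arise only at a later stage.\<close>

definition simulates_CT :: "'f signature \<Rightarrow> ('f, 'v, 'a) rule set \<Rightarrow> ('f, 'v, 'a) lit set \<Rightarrow> bool" where
  "simulates_CT Sig R C \<longleftrightarrow> C \<subseteq> CTplus Sig R \<and>
    (\<forall>m \<in> marked Sig R. \<forall>a p. Trans (left m) a p \<in> C \<longrightarrow>
      (\<exists>n \<in> marked Sig R. left n = p \<and> Trans (right m) a (right n) \<in> CTplus Sig R))"

text \<open>Lifting from right to left. A negative premise carries over by contraposition: a
  transition of the left projection in \<open>C\<close> would be answered by a certain transition on
  the right.\<close>

lemma simulates_PT:
  assumes format: "ntyft_ntyxt_rec Sig R" and C: "simulates_CT Sig R C"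
    and m: "m \<in> marked Sig R" and q: "Trans (right m) a q \<in> PTplus Sig R"
  shows "\<exists>n \<in> marked Sig R. right n = q \<and> Trans (left m) a (left n) \<in> PTpos Sig R C"
proof -
  have sub: "PTneg Sig (CTplus Sig R) \<subseteq> PTneg Sig C"
    using C by (intro PTneg_antimono) (simp add: simulates_CT_def)
  interpret marking Sig "bisim_pairs Sig R" snd by (rule marking_bisim_pairs)
  interpret lifting Sig "bisim_pairs Sig R" snd fst R "PTneg Sig (CTplus Sig R)" "PTneg Sig C"
  proof
    fix k a p
    assume k: "k \<in> bisim_pairs Sig R" and p: "proves Sig R (PTneg Sig (CTplus Sig R)) (Trans (snd k) a p)"
    have "closed_lit Sig (Trans (snd k) a p)"
      using proves_closed[OF p] format by (auto simp: ntyft_ntyxt_rec_def PTneg_def)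
    with p have "pt_trans Sig R (snd k) a p" by (simp add: pt_trans_def PTplus_eq PTpos_def)
    then obtain p' where "pt_trans Sig R (fst k) a p'" "bisim_pre Sig R p' p"
      using bisim_pre_pt[of Sig R "fst k" "snd k" a p] k by (auto simp: bisim_pairs_def)
    then show "\<exists>k' \<in> bisim_pairs Sig R. snd k' = p \<and> proves Sig R (PTneg Sig C) (Trans (fst k) a (fst k'))"
      using proves_mono[OF _ sub]
      by (intro bexI[of _ "(p', p)"]) (auto simp: pt_trans_def PTplus_eq PTpos_def bisim_pairs_def)
  next
    fix m a
    assume m: "closed (ext_sig Sig (tokens Sig (bisim_pairs Sig R))) m"
      and no: "NoTrans (right m) a \<in> PTneg Sig (CTplus Sig R)"
    then have m': "m \<in> marked Sig R" by (simp add: marked_def)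
    have "Trans (right m) a q \<notin> CTplus Sig R" for q
      using no by (auto simp: PTneg_def)
    then have "Trans (left m) a p \<notin> C" for p
      using C m' unfolding simulates_CT_def by blast
    then have "\<not> denies (NoTrans (left m) a) \<beta>" if "\<beta> \<in> C" for \<beta>
      using that by (cases \<beta>) auto
    then show "NoTrans (left m) a \<in> PTneg Sig C"
      using closed_left[OF m'] by (simp add: PTneg_def closed_lit_def)
  qed (use sub format in \<open>auto simp: PTneg_def bisim_pairs_def dest: bisim_pre_closed\<close>)
  have "proves Sig R (PTneg Sig (CTplus Sig R)) (Trans (right m) a q)"
    using q by (simp add: PTplus_eq PTpos_def)
  with lift_transition[of m a q] m obtain n where n: "n \<in> marked Sig R" "right n = q"
    "proves Sig R (PTneg Sig C) (Trans (left m) a (left n))"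
    by (auto simp: marked_def)
  then show ?thesis
    using closed_left m by (auto simp: PTpos_def closed_lit_def)
qed

text \<open>Lifting from left to right. A negative premise carries over because, by
  \<open>simulates_PT\<close>, a possible transition on the right would give one in
  \<open>PTpos Sig R C\<close> on the left. For the related pairs themselves,
  \<open>CTplus_fixed\<close> turns the answer given by bisimilarity into a proof from the final
  negative literals.\<close>

lemma simulates_CT_step:
  assumes format: "ntyft_ntyxt_rec Sig R" and C: "simulates_CT Sig R C"
  shows "simulates_CT Sig R (CTpos Sig R C)"
proof -
  have CT: "C \<subseteq> CTplus Sig R" using C by (simp add: simulates_CT_def)
  have sub: "CTneg Sig R C \<subseteq> CTneg Sig R (CTplus Sig R)"
    using CT by (rule CTneg_mono)
  have CTpos: "CTpos Sig R C \<subseteq> CTplus Sig R"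
    using CTpos_mono[OF CT] CTplus_fixed by blast
  interpret marking Sig "bisim_pairs Sig R" fst by (rule marking_bisim_pairs)
  interpret lifting Sig "bisim_pairs Sig R" fst snd R "CTneg Sig R C" "CTneg Sig R (CTplus Sig R)"
  proof
    fix k a p
    assume k: "k \<in> bisim_pairs Sig R" and p: "proves Sig R (CTneg Sig R C) (Trans (fst k) a p)"
    have "closed_lit Sig (Trans (fst k) a p)"
      using proves_closed[OF p] format by (auto simp: ntyft_ntyxt_rec_def CTneg_def)
    with p have "ct_trans Sig R (fst k) a p" using CTpos by (auto simp: ct_trans_def CTpos_def)
    then obtain q' where q': "ct_trans Sig R (snd k) a q'" "bisim_pre Sig R p q'"
      using bisim_pre_ct[of Sig R "fst k" "snd k" a p] k by (auto simp: bisim_pairs_def)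
    then have "proves Sig R (CTneg Sig R (CTplus Sig R)) (Trans (snd k) a q')"
      using CTplus_fixed[of Sig R] unfolding ct_trans_def CTpos_def by blast
    with q' show "\<exists>k' \<in> bisim_pairs Sig R. fst k' = p \<and>
        proves Sig R (CTneg Sig R (CTplus Sig R)) (Trans (snd k) a (snd k'))"
      by (intro bexI[of _ "(p, q')"]) (auto simp: bisim_pairs_def)
  next
    fix m a
    assume m: "closed (ext_sig Sig (tokens Sig (bisim_pairs Sig R))) m"
      and no: "NoTrans (left m) a \<in> CTneg Sig R C"
    then have m': "m \<in> marked Sig R" by (simp add: marked_def)
    have "Trans (left m) a p \<notin> PTpos Sig R C" for p
      using no by (auto simp: CTneg_def)
    then have "Trans (right m) a q \<notin> PTplus Sig R" for q
      using simulates_PT[OF format C m'] by blast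
    then have "\<not> denies (NoTrans (right m) a) \<beta>" if "\<beta> \<in> PTpos Sig R (CTplus Sig R)" for \<beta>
      using that by (cases \<beta>) (auto simp: PTplus_eq)
    then show "NoTrans (right m) a \<in> CTneg Sig R (CTplus Sig R)"
      using closed_right[OF m'] by (simp add: CTneg_def closed_lit_def)
  qed (use sub format in \<open>auto simp: CTneg_def bisim_pairs_def dest: bisim_pre_closed\<close>)
  have "\<exists>n \<in> marked Sig R. left n = p \<and> Trans (right m) a (right n) \<in> CTplus Sig R"
    if m: "m \<in> marked Sig R" and p: "Trans (left m) a p \<in> CTpos Sig R C" for m a p
  proof -
    have "proves Sig R (CTneg Sig R C) (Trans (left m) a p)"
      using p by (simp add: CTpos_def)
    with lift_transition[of m a p] m obtain n where n: "n \<in> marked Sig R" "left n = p"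
      "proves Sig R (CTneg Sig R (CTplus Sig R)) (Trans (right m) a (right n))"
      by (auto simp: marked_def)
    then have "Trans (right m) a (right n) \<in> CTpos Sig R (CTplus Sig R)"
      using closed_right m by (auto simp: CTpos_def closed_lit_def)
    with n show ?thesis using CTplus_fixed[of Sig R] by blast
  qed
  with CTpos show ?thesis by (auto simp: simulates_CT_def)
qed

lemma simulates_CT_CTplus:
  assumes "ntyft_ntyxt_rec Sig R"
  shows "simulates_CT Sig R (CTplus Sig R)"
proof (rule CTplus_induct)
  show "simulates_CT Sig R (\<Union>\<C>)" if "\<forall>C \<in> \<C>. simulates_CT Sig R C" for \<C>
    using that unfolding simulates_CT_def by blast
qed (rule simulates_CT_step[OF assms])

theorem mainTheorem6:
  fixes Sig :: "'f signature"
    and R :: "('f, 'v, 'a) rule set"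
    and t :: "('f, 'v) rterm"
    and \<rho> \<nu> :: "'v \<Rightarrow> ('f, 'v) rterm"
  assumes "ntyft_ntyxt_rec Sig R"
    and "wf_term Sig t"
    and "closed_subst Sig \<rho>"
    and "closed_subst Sig \<nu>"
    and "\<forall>x. bisim_pre Sig R (\<rho> x) (\<nu> x)"
  shows "bisim_pre Sig R (t\<lbrakk>\<rho>\<rbrakk>) (t\<lbrakk>\<nu>\<rbrakk>)"
proof -
  let ?Rel = "(\<lambda>m. (left m, right m)) ` marked Sig R"
  have CT: "simulates_CT Sig R (CTplus Sig R)" by (rule simulates_CT_CTplus[OF assms(1)])
  have "bisimulation Sig R ?Rel"
    unfolding bisimulation_def
  proof (safe; simp?)
    fix m a p'
    assume "m \<in> marked Sig R" "ct_trans Sig R (left m) a p'"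
    then show "\<exists>q'. ct_trans Sig R (right m) a q' \<and> (p', q') \<in> ?Rel"
      using CT unfolding simulates_CT_def ct_trans_def by force
  next
    fix m a q'
    assume m: "m \<in> marked Sig R" "pt_trans Sig R (right m) a q'"
    \<comment> \<open>For the stable set \<open>CTplus\<close>, the possible transitions computed
      from it are exactly \<open>PTplus\<close>.\<close>
    then obtain n where "n \<in> marked Sig R" "right n = q'" "Trans (left m) a (left n) \<in> PTplus Sig R"
      using simulates_PT[OF assms(1) CT] unfolding pt_trans_def PTplus_eq by blast
    then show "\<exists>p'. pt_trans Sig R (left m) a p' \<and> (p', q') \<in> ?Rel"
      unfolding pt_trans_def by force
  qed (auto intro: closed_left closed_right)
  \<comment> \<open>The tokens are admissible because the values of each variable are related by
    assumption; erasing them on either side recovers the two instances of \<open>t\<close>.\<close>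
  moreover define m :: "('f + (('f, 'v) rterm, ('f, 'v) rterm \<times> ('f, 'v) rterm) token, 'v) rterm"
    where "m = subst_aux (emb t) (\<lambda>x. tok (Known (\<rho> x, \<nu> x)))"
  let ?Sig' = "ext_sig Sig (tokens Sig (bisim_pairs Sig R))"
  have "closed_subst ?Sig' (\<lambda>x. tok (Known (\<rho> x, \<nu> x)))"
    using assms(5) by (auto simp: closed_subst_def closed_def bisim_pairs_def)
  then have "m \<in> marked Sig R"
    unfolding marked_def m_def using assms(2) by (auto intro: closed_subst_aux)
  moreover have "left m = t\<lbrakk>\<rho>\<rbrakk>" "right m = t\<lbrakk>\<nu>\<rbrakk>"
    by (simp_all add: m_def subst_def proj_subst_emb[OF assms(2)] comp_def)
  ultimately show ?thesis unfolding bisim_pre_def by force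
qed

end
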